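(* Let $(\pi_\rho,V_\rho)$ be an irreducible unitary representation of $Spin(n)$ and $V_\rho\otimes\mathbf{R}^n=\bigoplus_{k=0}^N V_{\lambda_k}$ its orthogonal decomposition into irreducible submodules. For a non-negative integer $q$ define the bilinear map $r^q_\rho:\mathbf{R}^n\times\mathbf{R}^n\to\mathrm{End}(V_\rho)$ by $r^0_\rho(u,v)=\langle u,v\rangle\,\mathrm{id}$ and, for $q\ge1$, $$r^q_\rho(u,v)=\Big(-\frac14\Big)^q\sum_{l_1,\dots,l_{q-1}=1}^n\pi_\rho([u,e_{l_1}])\pi_\rho([e_{l_1},e_{l_2}])\cdots\pi_\rho([e_{l_{q-1}},v]),$$ where $\{e_l\}$ is an orthonormal basis of $\mathbf{R}^n$ (for $q=1$ this is $-\frac14\pi_\rho([u,v])$). Then for every $q\ge0$ and all $u,v\in\mathbf{R}^n$, $$\sum_{k=0}^N m(\lambda_k)^q\big(p^\rho_{\lambda_k}(u)\big)^\ast p^\rho_{\lambda_k}(v)=r^q_\rho(u,v).$$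
   Context: $Cl_n$ is the real Clifford algebra of $\mathbf{R}^n$ with $xy+yx=-2\langle x,y\rangle$; $\mathfrak{spin}(n)=\mathrm{span}\{[e_k,e_l]\}\subset Cl_n$ ($[a,b]=ab-ba$), $Spin(n)=\exp\mathfrak{spin}(n)$, $\pi_{\mathrm{Ad}}(g)x=gxg^{-1}$. $\pi_\rho$ also denotes the infinitesimal representation. $V_\rho\otimes\mathbf{R}^n$ carries $\pi_\rho\otimes\pi_{\mathrm{Ad}}$ and the tensor inner product; its irreducible constituents have multiplicity one and are mutually orthogonal; $\Pi^\rho_{\lambda_k}$ is the orthogonal projection onto $V_{\lambda_k}$, the Clifford homomorphism is $p^\rho_{\lambda_k}(u)\phi:=\Pi^\rho_{\lambda_k}(\phi\otimes u)$, and $^\ast$ denotes the adjoint. The conformal weight $m(\lambda_k)$ is the scalar by which $\widehat C=\frac1{32}\sum_{i,j}\pi_\rho([e_i,e_j])\otimes\pi_{\mathrm{Ad}}([e_i,e_j])$ acts on $V_{\lambda_k}$, equivalently $m(\lambda_k)=\frac12(n-\|\delta+\lambda_k\|^2+\|\delta+\rho\|^2-1)$ with $\delta$ half the sum of positive roots. *)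

theory Defs
  imports "HOL-Analysis.Analysis"
begin

text \<open>R^n is real^'n with standard orthonormal basis e_l = axis l 1; the index type is
  linearly ordered so that the basis blades e_A (A a set of indices) can be ordered.
  Cl_n is realized as real^('n set): coordinates w.r.t. the blade basis e_A.
  Product of blades: e_A e_B = sign(A,B) e_(A symdiff B), where the sign counts the
  transpositions needed to sort, and a factor -1 for every e_i e_i = -1, so that
  x y + y x = -2 <x,y> for x, y in R^n.\<close>


definition bsign :: "'n::{finite,linorder} set \<Rightarrow> 'n::{finite,linorder} set \<Rightarrow> real" where
  "bsign A B = (-1) ^ (card {(a, b). a \<in> A \<and> b \<in> B \<and> b < a} + card (A \<inter> B))"

definition symd :: "'a set \<Rightarrow> 'a set \<Rightarrow> 'a set" where
  "symd A B = (A - B) \<union> (B - A)"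

definition cl_mult :: "real ^ ('n::{finite,linorder} set) \<Rightarrow> real ^ ('n::{finite,linorder} set) \<Rightarrow> real ^ ('n::{finite,linorder} set)" where
  "cl_mult x y = (\<chi> C. \<Sum>A\<in>UNIV. bsign A (symd A C) * x $ A * y $ (symd A C))"

definition cl_one :: "real ^ ('n::{finite,linorder} set)" where
  "cl_one = (\<chi> A. if A = {} then 1 else 0)"

primrec cl_pow :: "real ^ ('n::{finite,linorder} set) \<Rightarrow> nat \<Rightarrow> real ^ ('n::{finite,linorder} set)" where
  "cl_pow x 0 = cl_one"
| "cl_pow x (Suc k) = cl_mult x (cl_pow x k)"

definition cl_exp :: "real ^ ('n::{finite,linorder} set) \<Rightarrow> real ^ ('n::{finite,linorder} set)" where
  "cl_exp x = (\<Sum>k. inverse (fact k) *\<^sub>R cl_pow x k)"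

definition cl_inv :: "real ^ ('n::{finite,linorder} set) \<Rightarrow> real ^ ('n::{finite,linorder} set)" where
  "cl_inv g = (THE h. cl_mult g h = cl_one \<and> cl_mult h g = cl_one)"

definition cl_vec :: "real ^ 'n::{finite,linorder} \<Rightarrow> real ^ ('n::{finite,linorder} set)" where
  "cl_vec u = (\<chi> A. if card A = 1 then u $ (the_elem A) else 0)"

definition cl_deg1 :: "real ^ ('n::{finite,linorder} set) \<Rightarrow> real ^ 'n::{finite,linorder}" where
  "cl_deg1 x = (\<chi> l. x $ {l})"

definition cl_comm :: "real ^ ('n::{finite,linorder} set) \<Rightarrow> real ^ ('n::{finite,linorder} set) \<Rightarrow> real ^ ('n::{finite,linorder} set)" where
  "cl_comm a b = cl_mult a b - cl_mult b a"

definition ebas :: "'n::{finite,linorder} \<Rightarrow> real ^ 'n::{finite,linorder}" where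
  "ebas l = axis l 1"

definition spin_alg :: "(real ^ ('n::{finite,linorder} set)) set" where
  "spin_alg = span (range (\<lambda>(k, l). cl_comm (cl_vec (ebas k)) (cl_vec (ebas l))))"

definition Spin_grp :: "(real ^ ('n::{finite,linorder} set)) set" where
  "Spin_grp = cl_exp ` spin_alg"

definition Ad :: "real ^ ('n::{finite,linorder} set) \<Rightarrow> real ^ 'n::{finite,linorder} \<Rightarrow> real ^ 'n::{finite,linorder}" where
  "Ad g u = cl_deg1 (cl_mult (cl_mult g (cl_vec u)) (cl_inv g))"

definition cinner :: "complex ^ 'i::finite \<Rightarrow> complex ^ 'i \<Rightarrow> complex" where
  "cinner x y = (\<Sum>i\<in>UNIV. cnj (x $ i) * y $ i)"

definition cscale :: "complex \<Rightarrow> complex ^ 'i \<Rightarrow> complex ^ 'i" where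
  "cscale c x = (\<chi> i. c * x $ i)"

definition csubspace :: "(complex ^ 'i) set \<Rightarrow> bool" where
  "csubspace W \<longleftrightarrow> 0 \<in> W \<and> (\<forall>x\<in>W. \<forall>y\<in>W. x + y \<in> W) \<and> (\<forall>c. \<forall>x\<in>W. cscale c x \<in> W)"

definition cproj :: "(complex ^ 'i::finite) set \<Rightarrow> complex ^ 'i \<Rightarrow> complex ^ 'i" where
  "cproj W t = (THE w. w \<in> W \<and> (\<forall>x\<in>W. cinner x (t - w) = 0))"

definition cadj :: "(complex ^ 'i::finite \<Rightarrow> complex ^ 'j::finite) \<Rightarrow> complex ^ 'j \<Rightarrow> complex ^ 'i" where
  "cadj f = (THE g. \<forall>x y. cinner (f x) y = cinner x (g y))"

definition mat_adj :: "complex ^ 'a::finite ^ 'b::finite \<Rightarrow> complex ^ 'b ^ 'a" where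
  "mat_adj M = (\<chi> i j. cnj (M $ j $ i))"

definition unitary_mat :: "complex ^ 'a::finite ^ 'a \<Rightarrow> bool" where
  "unitary_mat M \<longleftrightarrow> mat_adj M ** M = mat 1"

definition unitary_rep :: "(real ^ ('n::{finite,linorder} set) \<Rightarrow> complex ^ 'd::finite ^ 'd) \<Rightarrow> bool" where
  "unitary_rep \<rho> \<longleftrightarrow> (\<forall>g\<in>Spin_grp. \<forall>h\<in>Spin_grp. \<rho> (cl_mult g h) = \<rho> g ** \<rho> h)
     \<and> (\<forall>g\<in>Spin_grp. unitary_mat (\<rho> g)) \<and> continuous_on Spin_grp \<rho>"

definition invariant :: "(real ^ ('n::{finite,linorder} set) \<Rightarrow> complex ^ 'i \<Rightarrow> complex ^ 'i) \<Rightarrow> (complex ^ 'i) set \<Rightarrow> bool" where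
  "invariant act W \<longleftrightarrow> (\<forall>g\<in>Spin_grp. \<forall>x\<in>W. act g x \<in> W)"

definition irred_submodule :: "(real ^ ('n::{finite,linorder} set) \<Rightarrow> complex ^ 'i \<Rightarrow> complex ^ 'i) \<Rightarrow> (complex ^ 'i) set \<Rightarrow> bool" where
  "irred_submodule act W \<longleftrightarrow> csubspace W \<and> W \<noteq> {0} \<and> invariant act W \<and>
     (\<forall>U. csubspace U \<and> U \<subseteq> W \<and> invariant act U \<longrightarrow> U = {0} \<or> U = W)"

definition irreducible_rep :: "(real ^ ('n::{finite,linorder} set) \<Rightarrow> complex ^ 'd::finite ^ 'd) \<Rightarrow> bool" where
  "irreducible_rep \<rho> \<longleftrightarrow> irred_submodule (\<lambda>g x. \<rho> g *v x) UNIV"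

definition rho_inf :: "(real ^ ('n::{finite,linorder} set) \<Rightarrow> complex ^ 'd::finite ^ 'd) \<Rightarrow> real ^ ('n::{finite,linorder} set) \<Rightarrow> complex ^ 'd ^ 'd" where
  "rho_inf \<rho> X = vector_derivative (\<lambda>t::real. \<rho> (cl_exp (t *\<^sub>R X))) (at 0)"

definition Ad_inf :: "real ^ ('n::{finite,linorder} set) \<Rightarrow> real ^ 'n::{finite,linorder} \<Rightarrow> real ^ 'n::{finite,linorder}" where
  "Ad_inf X u = vector_derivative (\<lambda>t::real. Ad (cl_exp (t *\<^sub>R X)) u) (at 0)"

definition tensor :: "complex ^ 'd::finite \<Rightarrow> real ^ 'n::{finite,linorder} \<Rightarrow> complex ^ ('d \<times> 'n::{finite,linorder})" where
  "tensor \<phi> u = (\<chi> p. \<phi> $ fst p * complex_of_real (u $ snd p))"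

definition tensor_op :: "complex ^ 'd::finite ^ 'd \<Rightarrow> (real ^ 'n::{finite,linorder} \<Rightarrow> real ^ 'n::{finite,linorder})
     \<Rightarrow> complex ^ ('d \<times> 'n::{finite,linorder}) \<Rightarrow> complex ^ ('d \<times> 'n::{finite,linorder})" where
  "tensor_op A B t = (\<chi> p. \<Sum>b\<in>UNIV. \<Sum>k\<in>UNIV.
       A $ fst p $ b * complex_of_real (B (ebas k) $ snd p) * t $ (b, k))"

definition tensor_act :: "(real ^ ('n::{finite,linorder} set) \<Rightarrow> complex ^ 'd::finite ^ 'd)
     \<Rightarrow> real ^ ('n::{finite,linorder} set) \<Rightarrow> complex ^ ('d \<times> 'n::{finite,linorder}) \<Rightarrow> complex ^ ('d \<times> 'n::{finite,linorder})" where
  "tensor_act \<rho> g = tensor_op (\<rho> g) (Ad g)"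

definition Cas :: "(real ^ ('n::{finite,linorder} set) \<Rightarrow> complex ^ 'd::finite ^ 'd)
     \<Rightarrow> complex ^ ('d \<times> 'n::{finite,linorder}) \<Rightarrow> complex ^ ('d \<times> 'n::{finite,linorder})" where
  "Cas \<rho> t = (1/32 :: real) *\<^sub>R (\<Sum>i\<in>UNIV. \<Sum>j\<in>UNIV.
      tensor_op (rho_inf \<rho> (cl_comm (cl_vec (ebas i)) (cl_vec (ebas j))))
                (Ad_inf (cl_comm (cl_vec (ebas i)) (cl_vec (ebas j)))) t)"

definition cliff_hom :: "(complex ^ ('d::finite \<times> 'n::{finite,linorder})) set \<Rightarrow> real ^ 'n::{finite,linorder}
     \<Rightarrow> complex ^ 'd \<Rightarrow> complex ^ ('d \<times> 'n::{finite,linorder})" where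
  "cliff_hom W u \<phi> = cproj W (tensor \<phi> u)"

fun rchain :: "(real ^ ('n::{finite,linorder} set) \<Rightarrow> complex ^ 'd::finite ^ 'd) \<Rightarrow> nat
     \<Rightarrow> real ^ 'n::{finite,linorder} \<Rightarrow> real ^ 'n::{finite,linorder} \<Rightarrow> complex ^ 'd ^ 'd" where
  "rchain \<rho> 0 u v = mat 0"
| "rchain \<rho> (Suc 0) u v = rho_inf \<rho> (cl_comm (cl_vec u) (cl_vec v))"
| "rchain \<rho> (Suc (Suc q)) u v =
     (\<Sum>l\<in>UNIV. rho_inf \<rho> (cl_comm (cl_vec u) (cl_vec (ebas l))) ** rchain \<rho> (Suc q) (ebas l) v)"

definition rq :: "(real ^ ('n::{finite,linorder} set) \<Rightarrow> complex ^ 'd::finite ^ 'd) \<Rightarrow> nat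
     \<Rightarrow> real ^ 'n::{finite,linorder} \<Rightarrow> real ^ 'n::{finite,linorder} \<Rightarrow> complex ^ 'd ^ 'd" where
  "rq \<rho> q u v = (if q = 0 then mat (complex_of_real (inner u v))
     else (\<chi> i j. (- 1/4 :: complex) ^ q * rchain \<rho> q u v $ i $ j))"

end

(*
The sum on the left is iota_u^* C^q iota_v, where iota_v phi = phi (x) v and C is the conformal weight
operator, since C is the scalar m(lambda_k) on the k-th orthogonal summand.  As
Ad([e_i, e_j]) w = 4 (<e_i, w> e_j - <e_j, w> e_i), the (c, k) block of C along the vector factor is
-1/4 rho([e_c, e_k]), so the blocks of C^q are the chains defining r^q.

The remaining point is the bilinearity of rho([u, v]) in u and v.  By Gram-Schmidt it reduces to
rho(X + Y) = rho(X) + rho(Y) for anticommuting X, Y with negative scalar squares, which follows by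
differentiating the Euler angle decomposition exp(t(X + Y)) = exp(aX) exp(bY) exp(aX) at t = 0; the
derivatives exist because continuous one-parameter groups of matrices are differentiable.
*)
theory Submission
  imports Defs
begin

text \<open>The obstacle is that no linearity is built into \<open>rho_inf\<close>. It is a
  \<open>vector_derivative\<close> along t -> \<rho>(e^{tX}), arbitrary where that curve is not
  differentiable, and \<rho> is only given as a continuous unitary homomorphism on
  \<open>Spin_grp\<close>. The chains r^q, however, have arbitrary end vectors u and v, whereas C is
  built from commutators of basis vectors, so linearity is required at both ends of a chain. Every
  element at which \<open>rho_inf\<close> is finally evaluated is a commutator [u, v]. Its square is
  a nonpositive scalar, so its exponential is a cosine plus a sine term and identities between
  exponentials become trigonometry. A general element of spin(n), such as e_1 e_2 + e_3 e_4, lacks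
  this property. With v fixed, [u, v] + [w, v] = [u + w, v] is again a commutator, so additivity
  never leaves this class.\<close>

section \<open>The Clifford algebra\<close>

notation cl_mult (infixl "\<odot>" 70)

abbreviation blade :: "'n::{finite,linorder} set \<Rightarrow> real ^ ('n set)" where
  "blade A \<equiv> axis A 1"

lemma symd_symd_cancel [simp]: "symd A (symd A B) = B" "symd {} A = A" "symd A {} = A" "symd A A = {}"
  by (auto simp: symd_def)

lemma symd_assoc: "symd (symd A B) C = symd A (symd B C)"
  by (auto simp: symd_def)

text \<open>Counting the pairs with b < a together with those with b = a gives a product of signs
  over A \<times> B. This form exposes multiplicativity under \<open>symd\<close> in each argument,
  on which associativity rests.\<close>

lemma bsign_eq_prod:
  "bsign A B = (\<Prod>a\<in>A. \<Prod>b\<in>B. if b \<le> a then - 1 else 1)"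
proof -
  have "{(a, b). a \<in> A \<and> b \<in> B \<and> b \<le> a}
      = {(a, b). a \<in> A \<and> b \<in> B \<and> b < a} \<union> (\<lambda>a. (a, a)) ` (A \<inter> B)"
    by auto
  moreover have "card \<dots> = card {(a, b). a \<in> A \<and> b \<in> B \<and> b < a} + card (A \<inter> B)"
    by (subst card_Un_disjoint) (auto simp: card_image inj_on_def)
  ultimately have "bsign A B = (- 1) ^ card {(a, b). a \<in> A \<and> b \<in> B \<and> b \<le> a}"
    by (simp add: bsign_def)
  also have "\<dots> = (\<Prod>p\<in>{(a, b). a \<in> A \<and> b \<in> B \<and> b \<le> a}. - 1)"
    by simp
  also have "\<dots> = (\<Prod>p\<in>A \<times> B. if snd p \<le> fst p then - 1 else 1)"
  proof -
    have "{(a, b). a \<in> A \<and> b \<in> B \<and> b \<le> a} = {p \<in> A \<times> B. snd p \<le> fst p}"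
      by auto
    then show ?thesis
      by (subst prod.inter_filter [symmetric]) simp_all
  qed
  also have "\<dots> = (\<Prod>a\<in>A. \<Prod>b\<in>B. if b \<le> a then - 1 else 1)"
    by (subst prod.cartesian_product) (auto intro!: prod.cong)
  finally show ?thesis .
qed

text \<open>The factors over A \<inter> B occur twice on the right and cancel, since each is a
  sign.\<close>

lemma prod_symd:
  fixes f :: "'a::finite \<Rightarrow> real"
  assumes "\<And>x. f x * f x = 1"
  shows "(\<Prod>x\<in>symd A B. f x) = (\<Prod>x\<in>A. f x) * (\<Prod>x\<in>B. f x)"
proof -
  have A: "(\<Prod>x\<in>A. f x) = (\<Prod>x\<in>A - B. f x) * (\<Prod>x\<in>A \<inter> B. f x)"
    by (subst prod.union_disjoint [symmetric]) (auto intro!: prod.cong)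
  have B: "(\<Prod>x\<in>B. f x) = (\<Prod>x\<in>B - A. f x) * (\<Prod>x\<in>A \<inter> B. f x)"
    by (subst prod.union_disjoint [symmetric]) (auto intro!: prod.cong)
  have "(\<Prod>x\<in>A \<inter> B. f x) * (\<Prod>x\<in>A \<inter> B. f x) = 1"
    by (simp add: prod.distrib [symmetric] assms)
  then have "(\<Prod>x\<in>A. f x) * (\<Prod>x\<in>B. f x) = (\<Prod>x\<in>A - B. f x) * (\<Prod>x\<in>B - A. f x)"
    unfolding A B by algebra
  also have "\<dots> = (\<Prod>x\<in>symd A B. f x)"
    unfolding symd_def by (subst prod.union_disjoint) auto
  finally show ?thesis by simp
qed

lemma bsign_symd_left: "bsign (symd A B) C = bsign A C * bsign B C"
  unfolding bsign_eq_prod by (rule prod_symd) (auto simp: prod.distrib [symmetric] intro!: prod.neutral)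

lemma bsign_symd_right: "bsign A (symd B C) = bsign A B * bsign A C"
  unfolding bsign_eq_prod prod.distrib [symmetric]
  by (intro prod.cong refl prod_symd) auto

lemma bsign_empty [simp]: "bsign {} A = 1" "bsign A {} = 1"
  by (simp_all add: bsign_def)

lemma bounded_bilinear_cl_mult:
  "bounded_bilinear (cl_mult :: real ^ ('n::{finite,linorder} set) \<Rightarrow> _)"
proof -
  have "bilinear (cl_mult :: real ^ ('n set) \<Rightarrow> _)"
    unfolding bilinear_def
    by (auto intro!: linearI simp: vec_eq_iff cl_mult_def algebra_simps sum.distrib sum_distrib_left)
  then show ?thesis
    by (simp add: bilinear_conv_bounded_bilinear)
qed

interpretation cl: bounded_bilinear cl_mult
  by (rule bounded_bilinear_cl_mult)

lemma blade_mult: "blade A \<odot> blade B = bsign A B *\<^sub>R blade (symd A B)"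
proof -
  have "(\<Sum>D\<in>UNIV. bsign D (symd D C) * blade A $ D * blade B $ symd D C)
      = (bsign A B *\<^sub>R blade (symd A B)) $ C" for C
  proof -
    have "(\<Sum>D\<in>UNIV. bsign D (symd D C) * blade A $ D * blade B $ symd D C)
        = (\<Sum>D\<in>UNIV. if D = A then bsign A (symd A C) * blade B $ symd A C else 0)"
      by (intro sum.cong) (auto simp: axis_def)
    moreover have "symd A C = B \<longleftrightarrow> C = symd A B"
      by auto
    ultimately show ?thesis
      by (auto simp: axis_def)
  qed
  then show ?thesis
    by (simp add: vec_eq_iff cl_mult_def)
qed

lemma cl_expand: "x = (\<Sum>A\<in>UNIV. x $ A *\<^sub>R blade A)"
  by (simp add: vec_eq_iff axis_def if_distrib cong: if_cong)

lemma cl_one_eq_blade: "cl_one = blade {}"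
  by (auto simp: cl_one_def axis_def vec_eq_iff)

text \<open>\<open>bsign\<close> is multiplicative in both arguments and hence a 2-cocycle: either
  bracketing of three blades has sign \<open>bsign A B * bsign A C * bsign B C\<close>.\<close>

lemma cl_mult_assoc: "x \<odot> y \<odot> z = x \<odot> (y \<odot> z)"
proof -
  have blade_assoc: "blade A \<odot> blade B \<odot> blade C = blade A \<odot> (blade B \<odot> blade C)"
    for A B C :: "'a set"
    by (simp add: blade_mult cl.scaleR_left cl.scaleR_right bsign_symd_left bsign_symd_right
        symd_assoc mult.assoc)
  have "(\<Sum>A\<in>UNIV. x $ A *\<^sub>R blade A) \<odot> (\<Sum>A\<in>UNIV. y $ A *\<^sub>R blade A) \<odot> (\<Sum>A\<in>UNIV. z $ A *\<^sub>R blade A)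
    = (\<Sum>A\<in>UNIV. x $ A *\<^sub>R blade A) \<odot> ((\<Sum>A\<in>UNIV. y $ A *\<^sub>R blade A) \<odot> (\<Sum>A\<in>UNIV. z $ A *\<^sub>R blade A))"
    by (simp only: cl.sum_left cl.sum_right cl.scaleR_left cl.scaleR_right blade_assoc)
  then show ?thesis
    by (simp only: cl_expand [symmetric])
qed

lemma cl_one_mult [simp]: "cl_one \<odot> x = x" "x \<odot> cl_one = x"
proof -
  have "cl_one \<odot> (\<Sum>A\<in>UNIV. x $ A *\<^sub>R blade A) = (\<Sum>A\<in>UNIV. x $ A *\<^sub>R blade A)"
       "(\<Sum>A\<in>UNIV. x $ A *\<^sub>R blade A) \<odot> cl_one = (\<Sum>A\<in>UNIV. x $ A *\<^sub>R blade A)"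
    by (simp_all only: cl.sum_left cl.sum_right cl.scaleR_left cl.scaleR_right cl_one_eq_blade
        blade_mult bsign_empty symd_symd_cancel scaleR_one)
  then show "cl_one \<odot> x = x" "x \<odot> cl_one = x"
    by (simp_all only: cl_expand [symmetric])
qed

lemma linear_cl_vec: "linear cl_vec"
  by (auto intro!: linearI simp: cl_vec_def vec_eq_iff)

lemmas cl_vec_linear_simps [simp] =
  linear_add [OF linear_cl_vec] linear_diff [OF linear_cl_vec] linear_cmul [OF linear_cl_vec]
  linear_0 [OF linear_cl_vec]

lemma cl_vec_ebas: "cl_vec (ebas i) = blade {i}"
  by (auto simp: cl_vec_def ebas_def axis_def vec_eq_iff card_1_singleton_iff)

lemma ebas_expand: "(\<Sum>i\<in>UNIV. u $ i *\<^sub>R ebas i) = u"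
  by (simp add: vec_eq_iff axis_def ebas_def if_distrib cong: if_cong)

lemma cl_vec_expand: "cl_vec w = (\<Sum>i\<in>UNIV. w $ i *\<^sub>R cl_vec (ebas i))"
  by (subst ebas_expand [of w, symmetric])
    (simp only: linear_sum [OF linear_cl_vec] linear_cmul [OF linear_cl_vec])

lemma cl_vec_mult_expand:
  "cl_vec u \<odot> cl_vec v = (\<Sum>i\<in>UNIV. \<Sum>j\<in>UNIV. (u $ i * v $ j) *\<^sub>R (cl_vec (ebas i) \<odot> cl_vec (ebas j)))"
  unfolding cl_vec_expand [of u] cl_vec_expand [of v] cl.sum_left cl.sum_right cl.scaleR_left
    cl.scaleR_right scaleR_scaleR scaleR_sum_right
  by (subst sum.swap) (simp add: mult.commute)

text \<open>Keeping the coefficients \<open>u $ i * v $ j\<close> for the reversed product lets both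
  products be added or subtracted term by term.\<close>

lemma cl_vec_mult_expand_swap:
  "cl_vec v \<odot> cl_vec u = (\<Sum>i\<in>UNIV. \<Sum>j\<in>UNIV. (u $ i * v $ j) *\<^sub>R (cl_vec (ebas j) \<odot> cl_vec (ebas i)))"
  unfolding cl_vec_mult_expand [of v u] by (subst sum.swap) (simp add: mult.commute)

lemma clifford_blade: "blade {i} \<odot> blade {j} + blade {j} \<odot> blade {i} = (if i = j then - 2 else 0) *\<^sub>R cl_one"
proof -
  have "symd {i} {j} = symd {j} {i}"
    by (auto simp: symd_def)
  moreover have "bsign {i} {j} = (if j \<le> i then -1 else 1)" for i j :: 'a
    by (simp add: bsign_eq_prod)
  ultimately show ?thesis
    by (auto simp: blade_mult cl_one_eq_blade simp flip: scaleR_add_left)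
qed

lemma clifford_relation:
  "cl_vec u \<odot> cl_vec v + cl_vec v \<odot> cl_vec u = (- 2 * inner u v) *\<^sub>R cl_one"
proof -
  have "cl_vec u \<odot> cl_vec v + cl_vec v \<odot> cl_vec u
      = (\<Sum>i\<in>UNIV. \<Sum>j\<in>UNIV. (u $ i * v $ j) *\<^sub>R (blade {i} \<odot> blade {j} + blade {j} \<odot> blade {i}))"
    by (simp add: cl_vec_mult_expand [of u v] cl_vec_mult_expand_swap [of v u] cl_vec_ebas
        scaleR_add_right sum.distrib)
  also have "\<dots> = (\<Sum>i\<in>UNIV. (- 2 * (u $ i * v $ i)) *\<^sub>R cl_one)"
    unfolding clifford_blade scaleR_scaleR
    by (simp add: if_distrib if_distribR mult.commute mult.assoc cong: if_cong)
  also have "\<dots> = (- 2 * inner u v) *\<^sub>R cl_one"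
    by (simp add: inner_vec_def sum_distrib_left scaleR_sum_left sum_negf)
  finally show ?thesis .
qed

lemma cl_vec_square: "cl_vec u \<odot> cl_vec u = (- inner u u) *\<^sub>R cl_one"
proof -
  have "2 *\<^sub>R (cl_vec u \<odot> cl_vec u) = 2 *\<^sub>R ((- inner u u) *\<^sub>R cl_one)"
    using clifford_relation [of u u] by (simp add: scaleR_2 [symmetric])
  then show ?thesis
    by (simp only: real_vector.scale_left_imp_eq [OF zero_neq_numeral [symmetric]])
qed

lemma cl_vec_anticommute:
  assumes "inner u v = 0"
  shows "cl_vec v \<odot> cl_vec u = - (cl_vec u \<odot> cl_vec v)"
  using clifford_relation [of u v] assms by (simp add: eq_neg_iff_add_eq_0 add.commute)

lemma cl_comm_cl_vec:
  "cl_comm (cl_vec u) (cl_vec v) = 2 *\<^sub>R (cl_vec u \<odot> cl_vec v + inner u v *\<^sub>R cl_one)"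
proof -
  have "cl_vec v \<odot> cl_vec u = (- 2 * inner u v) *\<^sub>R cl_one - cl_vec u \<odot> cl_vec v"
    using clifford_relation [of u v] by (simp only: eq_diff_eq add.commute)
  then show ?thesis
    unfolding cl_comm_def by (simp only:) (simp add: scaleR_2 scaleR_add_right scaleR_add_left)
qed

section \<open>Exponentials of elements with negative scalar square\<close>

lemma cl_pow_exp_coeff:
  assumes X: "X \<odot> X = - (l\<^sup>2) *\<^sub>R cl_one" and l: "l \<noteq> 0"
  shows "inverse (fact k) *\<^sub>R cl_pow (t *\<^sub>R X) k
    = (cos_coeff k * (t * l) ^ k) *\<^sub>R cl_one + (sin_coeff k * (t * l) ^ k / l) *\<^sub>R X"
proof (induction k)
  case 0
  then show ?case by (simp add: sin_coeff_def cos_coeff_def)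
next
  case (Suc k)
  \<comment> \<open>Multiplication by X exchanges the two summands, just as
    \<open>cos_coeff_Suc\<close> and \<open>sin_coeff_Suc\<close> exchange the coefficients; these
    vanish in the wrong parity, so one formula serves even and odd powers.\<close>
  have "inverse (fact (Suc k)) *\<^sub>R cl_pow (t *\<^sub>R X) (Suc k)
     = (t / real (Suc k)) *\<^sub>R (X \<odot> (inverse (fact k) *\<^sub>R cl_pow (t *\<^sub>R X) k))"
    by (simp add: cl.scaleR_left cl.scaleR_right field_simps)
  also have "\<dots> = (t / real (Suc k)) *\<^sub>R ((cos_coeff k * (t * l) ^ k) *\<^sub>R X
      + (sin_coeff k * (t * l) ^ k / l) *\<^sub>R (- (l\<^sup>2) *\<^sub>R cl_one))"
    by (simp add: Suc cl.scaleR_left cl.scaleR_right cl.add_right X)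
  also have "\<dots> = (cos_coeff (Suc k) * (t * l) ^ Suc k) *\<^sub>R cl_one
      + (sin_coeff (Suc k) * (t * l) ^ Suc k / l) *\<^sub>R X"
    using l by (simp add: cos_coeff_Suc sin_coeff_Suc scaleR_add_right power2_eq_square field_simps del: of_nat_Suc)
  finally show ?case .
qed

lemma cl_exp_eq_cos_sin:
  assumes X: "X \<odot> X = - (l\<^sup>2) *\<^sub>R cl_one" and l: "l \<noteq> 0"
  shows "cl_exp (t *\<^sub>R X) = cos (t * l) *\<^sub>R cl_one + (sin (t * l) / l) *\<^sub>R X"
proof -
  have "(\<lambda>k. inverse (fact k) *\<^sub>R cl_pow (t *\<^sub>R X) k) sums
      (cos (t * l) *\<^sub>R cl_one + (sin (t * l) / l) *\<^sub>R X)"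
    unfolding cl_pow_exp_coeff [OF X l]
    using cos_converges [of "t * l"] sin_converges [of "t * l"]
    by (intro sums_add sums_scaleR_left sums_divide) simp_all
  then show ?thesis
    unfolding cl_exp_def by (rule sums_unique [symmetric])
qed

lemma cl_exp_zero [simp]: "cl_exp 0 = cl_one"
proof -
  have "(\<lambda>k. inverse (fact k) *\<^sub>R cl_pow 0 k) sums (cl_one :: real ^ ('a set))"
  proof (rule sums_single [THEN sums_cong [THEN iffD1, rotated]])
    show "(if k = 0 then cl_one else 0) = inverse (fact k) *\<^sub>R cl_pow (0 :: real ^ ('a set)) k" for k
      by (cases k) (simp_all add: cl.zero_left)
  qed
  then show ?thesis
    unfolding cl_exp_def by (rule sums_unique [symmetric])
qed

lemma cl_inv_eq:
  assumes "g \<odot> h = cl_one" "h \<odot> g = cl_one"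
  shows "cl_inv g = h"
  unfolding cl_inv_def
proof (rule the_equality)
  show "g \<odot> h = cl_one \<and> h \<odot> g = cl_one"
    using assms by simp
  show "k = h" if "g \<odot> k = cl_one \<and> k \<odot> g = cl_one" for k
    using assms that cl_mult_assoc [of h g k] by simp
qed

section \<open>Continuous one-parameter groups of matrices\<close>

lemma bounded_bilinear_matrix_mult:
  "bounded_bilinear ((**) :: complex ^ 'a ^ 'b \<Rightarrow> complex ^ 'c ^ 'a \<Rightarrow> complex ^ 'c ^ 'b)"
proof -
  have "bilinear ((**) :: complex ^ 'a ^ 'b \<Rightarrow> complex ^ 'c ^ 'a \<Rightarrow> complex ^ 'c ^ 'b)"
    unfolding bilinear_def
    by (auto intro!: linearI simp: vec_eq_iff matrix_matrix_mult_def algebra_simps sum.distrib scaleR_sum_right)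
  then show ?thesis
    by (simp add: bilinear_conv_bounded_bilinear)
qed

interpretation mm: bounded_bilinear "(**) :: complex ^ 'a ^ 'b \<Rightarrow> complex ^ 'c ^ 'a \<Rightarrow> complex ^ 'c ^ 'b"
  by (rule bounded_bilinear_matrix_mult)

lemma tendsto_det:
  fixes M :: "'b \<Rightarrow> complex ^ 'a ^ 'a"
  assumes "(M \<longlongrightarrow> L) F"
  shows "((\<lambda>x. det (M x)) \<longlongrightarrow> det L) F"
  unfolding det_def by (intro tendsto_intros assms)

lemma matrix_one_parameter_group_differentiable:
  fixes F :: "real \<Rightarrow> complex ^ 'a ^ 'a"
  assumes cont: "continuous_on UNIV F" and F0: "F 0 = mat 1"
    and mult: "\<And>s t. F (s + t) = F s ** F t"
  obtains D where "(F has_vector_derivative D) (at 0)"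
proof -
  \<comment> \<open>For small \<open>h > 0\<close> the matrix \<open>\<integral>\<^sub>0\<^sup>h F\<close> is invertible, and \<open>F t ** \<integral>\<^sub>0\<^sup>h F = \<integral>\<^sub>t\<^sup>t\<^sup>+\<^sup>h F\<close> is differentiable in \<open>t\<close>.
    The integrals start at \<open>-1\<close> to allow negative \<open>t\<close>.\<close>
  define G where "G t = integral {-1..t} F" for t
  have integ: "F integrable_on {a..b}" for a b
    by (intro integrable_continuous_real continuous_on_subset [OF cont]) simp
  have G_deriv: "(G has_vector_derivative F t) (at t)" if "- 1 < t" "t < 1" for t
  proof -
    have "(G has_vector_derivative F t) (at t within {-1..1})"
      unfolding G_def using that
      by (intro integral_has_vector_derivative continuous_on_subset [OF cont]) auto
    moreover have "at t within {-1..1} = at t"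
      using that by (intro at_within_interior) simp
    ultimately show ?thesis by simp
  qed
  have J: "F t ** (G h - G 0) = G (t + h) - G t" if "- 1 < t" "0 < h" for t h
  proof -
    have "F t ** integral {0..h} F = integral {0..h} ((\<lambda>s. F t ** s) \<circ> F)"
      using integral_linear [OF integ mm.bounded_linear_right] by metis
    also have "(\<lambda>s. F t ** s) \<circ> F = F \<circ> (+) t"
      by (auto simp: mult)
    also have "integral {0..h} (F \<circ> (+) t) = integral {t..t + h} F"
      by (simp add: integral_shift_Icc_real add.commute)
    finally have "F t ** integral {0..h} F = integral {t..t + h} F" .
    moreover have "G (t + h) = G t + integral {t..t + h} F"
      unfolding G_def using that integ by (intro Henstock_Kurzweil_Integration.integral_combine [symmetric]) auto
    moreover have "G h = G 0 + integral {0..h} F"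
      unfolding G_def using that integ by (intro Henstock_Kurzweil_Integration.integral_combine [symmetric]) auto
    ultimately show ?thesis by simp
  qed
  \<comment> \<open>\<open>M h\<close> is a difference quotient of G at 0, so it tends to F 0 = mat
    1; by continuity of \<open>det\<close> it is invertible for small h.\<close>
  define M where "M h = inverse h *\<^sub>R (G h - G 0)" for h
  have "(M \<longlongrightarrow> mat 1) (at 0)"
  proof -
    have "((\<lambda>h. (G h - G 0 - h *\<^sub>R mat 1) /\<^sub>R norm h) \<longlongrightarrow> 0) (at 0)"
      using G_deriv [of 0] F0 unfolding has_vector_derivative_def has_derivative_at_within by simp
    then have "((\<lambda>h. M h - mat 1) \<longlongrightarrow> 0) (at 0)"
    proof (rule tendsto_norm_zero_cancel [OF Lim_transform_eventually [OF tendsto_norm_zero]])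
      show "eventually (\<lambda>h. norm ((G h - G 0 - h *\<^sub>R mat 1) /\<^sub>R norm h) = norm (M h - mat 1)) (at 0)"
        unfolding eventually_at_filter
      proof (intro always_eventually allI impI)
        fix h :: real assume "h \<noteq> 0"
        then have "M h - mat 1 = inverse h *\<^sub>R (G h - G 0 - h *\<^sub>R mat 1)"
          by (simp add: M_def scaleR_diff_right)
        then show "norm ((G h - G 0 - h *\<^sub>R mat 1) /\<^sub>R norm h) = norm (M h - mat 1)"
          by simp
      qed
    qed
    then show ?thesis
      by (rule LIM_zero_cancel)
  qed
  \<comment> \<open>\<open>J\<close> requires 0 < h, hence the one-sided limit; h < 1 keeps h where
    \<open>G_deriv\<close> applies.\<close>
  then have "((\<lambda>h. det (M h)) \<longlongrightarrow> det (mat 1 :: complex ^ 'a ^ 'a)) (at_right 0)"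
    by (intro tendsto_det) (rule tendsto_mono [OF at_le [OF subset_UNIV]])
  then have "eventually (\<lambda>h. det (M h) \<noteq> 0) (at_right 0)"
    by (rule tendsto_imp_eventually_ne) simp
  moreover have "eventually (\<lambda>h. 0 < h \<and> h < (1::real)) (at_right 0)"
    using eventually_at_right_real [of 0 1] by (simp add: greaterThanLessThan_iff)
  ultimately have "eventually (\<lambda>h. det (M h) \<noteq> 0 \<and> 0 < h \<and> h < 1) (at_right 0)"
    by eventually_elim auto
  then obtain h where h: "det (M h) \<noteq> 0" "0 < h" "h < 1"
    using eventually_happens [of _ "at_right (0::real)"] by auto
  then obtain M' where M': "M h ** M' = mat 1"
    using invertible_det_nz [of "M h"] unfolding invertible_def by blast
  have F_eq: "F t = inverse h *\<^sub>R ((G (t + h) - G t) ** M')" if "- 1 < t" for t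
  proof -
    have "inverse h *\<^sub>R ((G (t + h) - G t) ** M') = F t ** M h ** M'"
      by (simp add: J [OF that h(2), symmetric] M_def mm.scaleR_left mm.scaleR_right)
    also have "\<dots> = F t"
      by (simp add: M' flip: matrix_mul_assoc)
    finally show ?thesis by simp
  qed
  have "((\<lambda>t. G (t + h)) has_vector_derivative F h) (at 0)"
  proof -
    have "((\<lambda>t. t + h) has_vector_derivative 1) (at 0)"
      by (auto intro!: derivative_eq_intros simp flip: has_real_derivative_iff_has_vector_derivative)
    then show ?thesis
      using vector_diff_chain_at [of "\<lambda>t. t + h" 1 0 G "F h"] G_deriv [of h] h by (simp add: o_def)
  qed
  moreover have "(G has_vector_derivative F 0) (at 0)"
    by (rule G_deriv) auto
  ultimately have "((\<lambda>t. G (t + h) - G t) has_vector_derivative (F h - F 0)) (at 0)"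
    by (rule has_vector_derivative_diff)
  then have "((\<lambda>t. (G (t + h) - G t) ** M') has_vector_derivative ((F h - F 0) ** M')) (at 0)"
    by (rule bounded_linear.has_vector_derivative [OF mm.bounded_linear_left])
  then have "((\<lambda>t. inverse h *\<^sub>R ((G (t + h) - G t) ** M')) has_vector_derivative inverse h *\<^sub>R ((F h - F 0) ** M')) (at 0)"
    by (rule bounded_linear.has_vector_derivative [OF bounded_linear_scaleR_right])
  then have "(F has_vector_derivative inverse h *\<^sub>R ((F h - F 0) ** M')) (at 0)"
    by (rule has_vector_derivative_transform_within_open [where S = "{-1<..<1}"])
       (auto simp: F_eq)
  then show ?thesis
    by (rule that)
qed

section \<open>The infinitesimal representation\<close>

lemma cl_comm_in_spin_alg: "cl_comm (cl_vec u) (cl_vec v) \<in> spin_alg"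
proof -
  have gen: "cl_comm (cl_vec (ebas i)) (cl_vec (ebas j)) \<in> (spin_alg :: (real ^ ('a set)) set)" for i j :: 'a
    unfolding spin_alg_def by (rule span_base) auto
  have "cl_comm (cl_vec u) (cl_vec v)
      = (\<Sum>i\<in>UNIV. \<Sum>j\<in>UNIV. (u $ i * v $ j) *\<^sub>R cl_comm (cl_vec (ebas i)) (cl_vec (ebas j)))"
    by (simp add: cl_comm_def cl_vec_mult_expand [of u v] cl_vec_mult_expand_swap [of v u]
        scaleR_diff_right sum_subtractf)
  also have "\<dots> \<in> spin_alg"
    using gen unfolding spin_alg_def by (intro span_sum span_scale) auto
  finally show ?thesis .
qed

lemma scaleR_in_spin_alg: "X \<in> spin_alg \<Longrightarrow> c *\<^sub>R X \<in> spin_alg"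
  and add_in_spin_alg: "X \<in> spin_alg \<Longrightarrow> Y \<in> spin_alg \<Longrightarrow> X + Y \<in> spin_alg"
  unfolding spin_alg_def by (simp_all add: span_scale span_add)

lemma cl_exp_in_Spin_grp: "X \<in> spin_alg \<Longrightarrow> cl_exp (t *\<^sub>R X) \<in> Spin_grp"
  unfolding Spin_grp_def by (intro imageI scaleR_in_spin_alg)

text \<open>The real multiples of square roots of -1 in Cl_n. Zero is included because [u, v]
  vanishes for parallel u and v.\<close>

definition neg_square :: "real ^ ('n::{finite,linorder} set) \<Rightarrow> bool" where
  "neg_square X \<longleftrightarrow> X = 0 \<or> (\<exists>l. l \<noteq> 0 \<and> X \<odot> X = - (l\<^sup>2) *\<^sub>R cl_one)"

lemma neg_squareI: "X \<odot> X = - (l\<^sup>2) *\<^sub>R cl_one \<Longrightarrow> l \<noteq> 0 \<Longrightarrow> neg_square X"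
  unfolding neg_square_def by blast

lemma neg_square_cases:
  assumes "neg_square X"
  obtains "X = 0" | l where "l > 0" "X \<odot> X = - (l\<^sup>2) *\<^sub>R cl_one"
proof (cases "X = 0")
  case False
  then obtain l where "l \<noteq> 0" "X \<odot> X = - (l\<^sup>2) *\<^sub>R cl_one"
    using assms by (auto simp: neg_square_def)
  then show ?thesis
    using that(2) [of "\<bar>l\<bar>"] by simp
qed (use that in blast)

text \<open>On the plane spanned by \<open>cl_one\<close> and X the exponential is that of complex
  numbers, so the law reduces to the addition formulas for sine and cosine.\<close>

lemma cl_exp_add:
  assumes "neg_square X"
  shows "cl_exp ((s + t) *\<^sub>R X) = cl_exp (s *\<^sub>R X) \<odot> cl_exp (t *\<^sub>R X)"
  using assms
proof (cases rule: neg_square_cases)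
  case 1
  then show ?thesis by simp
next
  case (2 l)
  then have l: "l \<noteq> 0" by simp
  show ?thesis
    unfolding cl_exp_eq_cos_sin [OF 2(2) l] using l
    by (simp add: cl.add_left cl.add_right cl.scaleR_left cl.scaleR_right 2 cos_add sin_add
        algebra_simps add_divide_distrib diff_divide_distrib power2_eq_square)
qed

lemma cl_exp_minus_mult:
  assumes "neg_square X"
  shows "cl_exp (- t *\<^sub>R X) \<odot> cl_exp (t *\<^sub>R X) = cl_one"
    and "cl_exp (t *\<^sub>R X) \<odot> cl_exp (- t *\<^sub>R X) = cl_one"
  using cl_exp_add [OF assms, of t "- t"] cl_exp_add [OF assms, of "- t" t] by simp_all

lemma continuous_on_cl_exp:
  assumes "neg_square X"
  shows "continuous_on UNIV (\<lambda>t. cl_exp (t *\<^sub>R X))"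
  using assms
proof (cases rule: neg_square_cases)
  case 1
  then show ?thesis by simp
next
  case (2 l)
  then have l: "l \<noteq> 0" by simp
  show ?thesis
    unfolding cl_exp_eq_cos_sin [OF 2(2) l] by (intro continuous_intros) (use l in auto)
qed

text \<open>\<open>unitary_rep\<close> does not postulate this: the matrix is idempotent and has a
  left inverse by unitarity.\<close>

lemma unitary_rep_one:
  assumes "unitary_rep \<rho>"
  shows "\<rho> cl_one = mat 1"
proof -
  have one: "cl_one \<in> Spin_grp"
    using cl_exp_in_Spin_grp [OF cl_comm_in_spin_alg, of 0] by simp
  then have "\<rho> cl_one = \<rho> cl_one ** \<rho> cl_one" "mat_adj (\<rho> cl_one) ** \<rho> cl_one = mat 1"
    using assms unfolding unitary_rep_def unitary_mat_def by (metis cl_one_mult(1), blast)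
  then have "mat 1 = mat_adj (\<rho> cl_one) ** (\<rho> cl_one ** \<rho> cl_one)"
    by simp
  also have "\<dots> = \<rho> cl_one"
    by (simp only: matrix_mul_assoc \<open>mat_adj (\<rho> cl_one) ** \<rho> cl_one = mat 1\<close> matrix_mul_lid)
  finally show ?thesis by simp
qed

text \<open>Certifies that the \<open>vector_derivative\<close> inside \<open>rho_inf\<close> is an
  actual derivative, since t -> \<rho>(e^{tX}) is a continuous one-parameter group.\<close>

lemma has_vector_derivative_rho_inf:
  assumes rep: "unitary_rep \<rho>" and X: "X \<in> spin_alg" "neg_square X"
  shows "((\<lambda>t. \<rho> (cl_exp (t *\<^sub>R X))) has_vector_derivative rho_inf \<rho> X) (at 0)"
proof -
  define F where "F t = \<rho> (cl_exp (t *\<^sub>R X))" for t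
  have "continuous_on UNIV F"
    unfolding F_def
  proof (rule continuous_on_compose2 [OF _ continuous_on_cl_exp [OF X(2)]])
    show "continuous_on Spin_grp \<rho>"
      using rep by (simp add: unitary_rep_def)
  qed (use cl_exp_in_Spin_grp X in auto)
  moreover have "F 0 = mat 1"
    by (simp add: F_def unitary_rep_one [OF rep])
  moreover have "F (s + t) = F s ** F t" for s t
    using rep cl_exp_in_Spin_grp [OF X(1)] by (simp add: F_def cl_exp_add [OF X(2)] unitary_rep_def)
  ultimately obtain D where "(F has_vector_derivative D) (at 0)"
    by (rule matrix_one_parameter_group_differentiable)
  then show ?thesis
    unfolding rho_inf_def F_def by (simp add: vector_derivative_at)
qed

lemma has_vector_derivative_rho_inf_chain:
  assumes rep: "unitary_rep \<rho>" and X: "X \<in> spin_alg" "neg_square X"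
    and f: "(f has_real_derivative f') (at 0)" "f 0 = 0"
  shows "((\<lambda>t. \<rho> (cl_exp (f t *\<^sub>R X))) has_vector_derivative f' *\<^sub>R rho_inf \<rho> X) (at 0)"
  using vector_diff_chain_at [of f f' 0 "\<lambda>t. \<rho> (cl_exp (t *\<^sub>R X))" "rho_inf \<rho> X"]
    f has_vector_derivative_rho_inf [OF rep X]
  by (simp add: o_def has_real_derivative_iff_has_vector_derivative)

lemma rho_inf_scaleR:
  assumes rep: "unitary_rep \<rho>" and X: "X \<in> spin_alg" "neg_square X"
  shows "rho_inf \<rho> (c *\<^sub>R X) = c *\<^sub>R rho_inf \<rho> X"
proof -
  have "((\<lambda>t. \<rho> (cl_exp ((t * c) *\<^sub>R X))) has_vector_derivative c *\<^sub>R rho_inf \<rho> X) (at 0)"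
    by (rule has_vector_derivative_rho_inf_chain [OF rep X]) (auto intro!: derivative_eq_intros)
  then show ?thesis
    unfolding rho_inf_def by (intro vector_derivative_at) simp
qed

text \<open>Spherical coordinates: the unit vector (cos \<theta>, p sin \<theta>, q sin \<theta>)
  has latitude \<open>arcsin (q * sin \<theta>)\<close> and longitude
  \<open>arctan (p * tan \<theta>)\<close>. The bound on \<theta> makes cos \<theta> positive, which
  places the longitude on the principal branch of arctan.\<close>

lemma rotation_angles:
  fixes p q \<theta> :: real
  assumes pq: "p\<^sup>2 + q\<^sup>2 = 1" "q > 0" and \<theta>: "\<bar>\<theta>\<bar> < pi / 2"
  shows "sin (arcsin (q * sin \<theta>)) = q * sin \<theta>"
    and "cos (arcsin (q * sin \<theta>)) * cos (arctan (p * tan \<theta>)) = cos \<theta>"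
    and "cos (arcsin (q * sin \<theta>)) * sin (arctan (p * tan \<theta>)) = p * sin \<theta>"
proof -
  have "q\<^sup>2 \<le> 1\<^sup>2"
    using pq by (smt (verit) power_one zero_le_power2)
  then have "q \<le> 1"
    by (rule power2_le_imp_le) simp
  then have "\<bar>q * sin \<theta>\<bar> \<le> 1"
    using mult_mono [of "\<bar>q\<bar>" 1 "\<bar>sin \<theta>\<bar>" 1] pq by (simp add: abs_mult)
  then have b: "-1 \<le> q * sin \<theta>" "q * sin \<theta> \<le> 1"
    by auto
  then show "sin (arcsin (q * sin \<theta>)) = q * sin \<theta>"
    by simp
  have c: "cos \<theta> > 0"
    using \<theta> by (intro cos_gt_zero_pi) auto
  have pos: "1 + (p * tan \<theta>)\<^sup>2 > 0"
    by (smt (verit) zero_le_power2)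
  \<comment> \<open>The squared cosine of the latitude. Its square root cancels the root in the
    formulas for sine and cosine of arctan.\<close>
  have "1 - (q * sin \<theta>)\<^sup>2 = (cos \<theta>)\<^sup>2 * (1 + (p * tan \<theta>)\<^sup>2)"
  proof -
    have "(cos \<theta>)\<^sup>2 * (1 + (p * tan \<theta>)\<^sup>2) = (cos \<theta>)\<^sup>2 + p\<^sup>2 * (sin \<theta>)\<^sup>2"
      using c by (simp add: tan_def field_simps power2_eq_square)
    moreover have "1 - (q * sin \<theta>)\<^sup>2 = (cos \<theta>)\<^sup>2 + p\<^sup>2 * (sin \<theta>)\<^sup>2"
    proof -
      have "q\<^sup>2 = 1 - p\<^sup>2"
        using pq by simp
      then show ?thesis
        by (simp only: power_mult_distrib) (simp add: cos_squared_eq left_diff_distrib)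
    qed
    ultimately show ?thesis by simp
  qed
  then have "cos (arcsin (q * sin \<theta>)) = cos \<theta> * sqrt (1 + (p * tan \<theta>)\<^sup>2)"
    using b c by (simp add: cos_arcsin real_sqrt_mult)
  then show "cos (arcsin (q * sin \<theta>)) * cos (arctan (p * tan \<theta>)) = cos \<theta>"
    and "cos (arcsin (q * sin \<theta>)) * sin (arctan (p * tan \<theta>)) = p * sin \<theta>"
    using pos c by (simp_all add: cos_arctan sin_arctan tan_def)
qed

text \<open>The angles solve \<open>e\<^bsup>aX\<^esup> e\<^bsup>bY\<^esup> e\<^bsup>aX\<^esup> = cos (bm) e\<^bsup>2aX\<^esup> + (sin (bm) / m) Y = e\<^bsup>t(X+Y)\<^esup>\<close>, where the
  first equality holds because \<open>e\<^bsup>aX\<^esup> Y = Y e\<^bsup>-aX\<^esup>\<close>.\<close>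

lemma cl_exp_add_anticommute:
  fixes a b t l m :: real
  assumes X: "X \<odot> X = - (l\<^sup>2) *\<^sub>R cl_one" "l > 0"
    and Y: "Y \<odot> Y = - (m\<^sup>2) *\<^sub>R cl_one" "m > 0"
    and XY: "Y \<odot> X = - (X \<odot> Y)"
  defines "\<nu> \<equiv> sqrt (l\<^sup>2 + m\<^sup>2)"
  assumes t: "\<bar>\<nu> * t\<bar> < pi / 2"
  defines "a \<equiv> arctan (l / \<nu> * tan (\<nu> * t)) / (2 * l)"
    and "b \<equiv> arcsin (m / \<nu> * sin (\<nu> * t)) / m"
  shows "cl_exp (t *\<^sub>R (X + Y)) = cl_exp (a *\<^sub>R X) \<odot> (cl_exp (b *\<^sub>R Y) \<odot> cl_exp (a *\<^sub>R X))"
proof -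
  have \<nu>: "\<nu> > 0" "\<nu>\<^sup>2 = l\<^sup>2 + m\<^sup>2"
    using X Y by (auto simp: \<nu>_def add_pos_pos)
  \<comment> \<open>With respect to 1, X/l, Y/m the element e^{t(X+Y)} has coordinates cos \<nu>t,
    (l/\<nu>) sin \<nu>t, (m/\<nu>) sin \<nu>t. Latitude and longitude of this unit vector are bm
    and 2al; the 2 is there because e^{aX} occurs twice.\<close>
  have pq: "(l / \<nu>)\<^sup>2 + (m / \<nu>)\<^sup>2 = 1" "m / \<nu> > 0"
    using \<nu> Y by (auto simp: power_divide add_divide_distrib [symmetric])
  note angles = rotation_angles [OF pq t]
  have sq: "(X + Y) \<odot> (X + Y) = - (\<nu>\<^sup>2) *\<^sub>R cl_one"
    by (simp add: cl.add_left cl.add_right X Y XY \<nu>(2) scaleR_diff_left)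
  have nX: "neg_square X"
    using X by (intro neg_squareI) auto
  have eX: "cl_exp (s *\<^sub>R X) = cos (s * l) *\<^sub>R cl_one + (sin (s * l) / l) *\<^sub>R X" for s
    using X by (intro cl_exp_eq_cos_sin) auto
  have "cl_exp (a *\<^sub>R X) \<odot> Y = Y \<odot> cl_exp (- a *\<^sub>R X)"
    unfolding eX by (simp add: cl.add_left cl.add_right cl.diff_right cl.scaleR_left cl.scaleR_right XY)
  then have conj: "cl_exp (a *\<^sub>R X) \<odot> (Y \<odot> cl_exp (a *\<^sub>R X)) = Y"
    by (simp add: cl_mult_assoc cl_exp_minus_mult [OF nX] flip: cl_mult_assoc [of "cl_exp (a *\<^sub>R X)"])
       (metis cl_exp_minus_mult(1) [OF nX] cl_mult_assoc cl_one_mult(2) scaleR_minus_left)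
  have "cl_exp (b *\<^sub>R Y) = cos (b * m) *\<^sub>R cl_one + (sin (b * m) / m) *\<^sub>R Y"
    using Y by (intro cl_exp_eq_cos_sin) auto
  then have "cl_exp (a *\<^sub>R X) \<odot> (cl_exp (b *\<^sub>R Y) \<odot> cl_exp (a *\<^sub>R X))
     = cos (b * m) *\<^sub>R cl_exp ((a + a) *\<^sub>R X) + (sin (b * m) / m) *\<^sub>R Y"
    by (simp only: cl.add_left cl.add_right cl.scaleR_left cl.scaleR_right cl_one_mult conj cl_exp_add [OF nX])
  also have "\<dots> = cos (\<nu> * t) *\<^sub>R cl_one + (sin (\<nu> * t) / \<nu>) *\<^sub>R (X + Y)"
  proof -
    have [simp]: "b * m = arcsin (m / \<nu> * sin (\<nu> * t))" "(a + a) * l = arctan (l / \<nu> * tan (\<nu> * t))"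
      using X Y by (simp_all add: a_def b_def)
    have "cos (b * m) * (sin ((a + a) * l) / l) = sin (\<nu> * t) / \<nu>"
      "sin (b * m) / m = sin (\<nu> * t) / \<nu>" "cos (b * m) * cos ((a + a) * l) = cos (\<nu> * t)"
      using angles X(2) Y(2) by (simp_all only: times_divide_eq_right \<open>b * m = _\<close> \<open>(a + a) * l = _\<close>) auto
    then show ?thesis
      by (simp only: eX scaleR_add_right scaleR_scaleR add.assoc)
  qed
  also have "\<dots> = cl_exp (t *\<^sub>R (X + Y))"
    using cl_exp_eq_cos_sin [OF sq, of t] \<nu> by (simp add: mult.commute)
  finally show ?thesis by simp
qed

lemma rho_inf_add_anticommute:
  assumes rep: "unitary_rep \<rho>" and X: "X \<in> spin_alg" "neg_square X" and Y: "Y \<in> spin_alg" "neg_square Y"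
    and XY: "Y \<odot> X = - (X \<odot> Y)"
  shows "rho_inf \<rho> (X + Y) = rho_inf \<rho> X + rho_inf \<rho> Y"
proof (cases "X = 0 \<or> Y = 0")
  case True
  moreover have "rho_inf \<rho> 0 = 0"
    using rho_inf_scaleR [OF rep X, of 0] by simp
  ultimately show ?thesis by auto
next
  case False
  obtain l where l: "l > 0" "X \<odot> X = - (l\<^sup>2) *\<^sub>R cl_one"
    using X(2) False by (cases rule: neg_square_cases) auto
  obtain m where m: "m > 0" "Y \<odot> Y = - (m\<^sup>2) *\<^sub>R cl_one"
    using Y(2) False by (cases rule: neg_square_cases) auto
  define \<nu> where "\<nu> = sqrt (l\<^sup>2 + m\<^sup>2)"
  have \<nu>: "\<nu> > 0" "\<nu>\<^sup>2 = l\<^sup>2 + m\<^sup>2"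
    using l m by (auto simp: \<nu>_def add_pos_pos)
  have "(X + Y) \<odot> (X + Y) = - (\<nu>\<^sup>2) *\<^sub>R cl_one"
    by (simp add: cl.add_left cl.add_right l m XY \<nu>(2) scaleR_diff_left)
  then have "neg_square (X + Y)"
    by (rule neg_squareI) (use \<nu> in auto)
  with X Y have Z: "X + Y \<in> spin_alg" "neg_square (X + Y)"
    by (auto intro: add_in_spin_alg)
  define a where "a t = arctan (l / \<nu> * tan (\<nu> * t)) / (2 * l)" for t
  define b where "b t = arcsin (m / \<nu> * sin (\<nu> * t)) / m" for t
  \<comment> \<open>The slopes at 0 are (l/\<nu>) \<nu> / (2l) = 1/2 for a and (m/\<nu>) \<nu> / m =
    1 for b: each outer factor e^{aX} carries half of X.\<close>
  have a: "(a has_real_derivative 1 / 2) (at 0)" "a 0 = 0"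
    unfolding a_def using \<nu> l by (auto intro!: derivative_eq_intros)
  have b: "(b has_real_derivative 1) (at 0)" "b 0 = 0"
    unfolding b_def using \<nu> m by (auto intro!: derivative_eq_intros)
  \<comment> \<open>Only products of two elements of the form \<open>e\<^bsup>Z\<^esup>\<close> are compared, so closure of \<^term>\<open>Spin_grp\<close>
    under multiplication is not needed.\<close>
  define L where "L t = \<rho> (cl_exp (- a t *\<^sub>R X)) ** \<rho> (cl_exp (t *\<^sub>R (X + Y)))" for t
  define R where "R t = \<rho> (cl_exp (b t *\<^sub>R Y)) ** \<rho> (cl_exp (a t *\<^sub>R X))" for t
  have "(L has_vector_derivative
     \<rho> (cl_exp (- a 0 *\<^sub>R X)) ** (1 *\<^sub>R rho_inf \<rho> (X + Y)) + ((- 1/2) *\<^sub>R rho_inf \<rho> X) ** \<rho> (cl_exp (0 *\<^sub>R (X + Y)))) (at 0)"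
    unfolding L_def
    by (intro mm.has_vector_derivative has_vector_derivative_rho_inf_chain [OF rep X] has_vector_derivative_rho_inf_chain [OF rep Z])
       (use a in \<open>auto intro!: derivative_eq_intros\<close>)
  then have L: "(L has_vector_derivative rho_inf \<rho> (X + Y) - (1 / 2) *\<^sub>R rho_inf \<rho> X) (at 0)"
    by (simp add: a unitary_rep_one [OF rep] mm.minus_left)
  have "(R has_vector_derivative
     \<rho> (cl_exp (b 0 *\<^sub>R Y)) ** ((1 / 2) *\<^sub>R rho_inf \<rho> X) + (1 *\<^sub>R rho_inf \<rho> Y) ** \<rho> (cl_exp (a 0 *\<^sub>R X))) (at 0)"
    unfolding R_def
    by (intro mm.has_vector_derivative has_vector_derivative_rho_inf_chain [OF rep X] has_vector_derivative_rho_inf_chain [OF rep Y] a b)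
  then have R: "(R has_vector_derivative (1 / 2) *\<^sub>R rho_inf \<rho> X + rho_inf \<rho> Y) (at 0)"
    by (simp add: a b unitary_rep_one [OF rep])
  have LR: "L t = R t" if "t \<in> {- (pi / 2 / \<nu>) <..< pi / 2 / \<nu>}" for t
  proof -
    have "\<bar>\<nu> * t\<bar> < pi / 2"
      using that \<nu> by (auto simp: abs_less_iff field_simps)
    then have "cl_exp (t *\<^sub>R (X + Y)) = cl_exp (a t *\<^sub>R X) \<odot> (cl_exp (b t *\<^sub>R Y) \<odot> cl_exp (a t *\<^sub>R X))"
      unfolding a_def b_def \<nu>_def by (intro cl_exp_add_anticommute l m XY)
    then have "cl_exp (- a t *\<^sub>R X) \<odot> cl_exp (t *\<^sub>R (X + Y)) = cl_exp (b t *\<^sub>R Y) \<odot> cl_exp (a t *\<^sub>R X)"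
      by (simp only: cl_mult_assoc [symmetric] cl_exp_minus_mult [OF X(2)] cl_one_mult)
    then show ?thesis
      using rep cl_exp_in_Spin_grp X(1) Y(1) Z(1) unfolding L_def R_def unitary_rep_def by metis
  qed
  have "(R has_vector_derivative rho_inf \<rho> (X + Y) - (1 / 2) *\<^sub>R rho_inf \<rho> X) (at 0)"
    by (rule has_vector_derivative_transform_within_open [OF L, where S = "{- (pi / 2 / \<nu>) <..< pi / 2 / \<nu>}"])
       (use \<nu> LR in auto)
  from vector_derivative_unique_at [OF this R]
  have "rho_inf \<rho> (X + Y) = (1 / 2) *\<^sub>R rho_inf \<rho> X + rho_inf \<rho> Y + (1 / 2) *\<^sub>R rho_inf \<rho> X"
    by (simp only: diff_eq_eq)
  also have "\<dots> = (1 / 2 + 1 / 2) *\<^sub>R rho_inf \<rho> X + rho_inf \<rho> Y"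
    by (simp only: scaleR_add_left add_ac)
  finally show ?thesis by simp
qed

section \<open>Commutators of vectors and linearity of \<open>rho_inf\<close> on them\<close>

lemma cl_mult_orthogonal_square:
  assumes "inner u v = 0"
  shows "(cl_vec u \<odot> cl_vec v) \<odot> (cl_vec u \<odot> cl_vec v) = - ((norm u * norm v)\<^sup>2) *\<^sub>R cl_one"
proof -
  have "(cl_vec u \<odot> cl_vec v) \<odot> (cl_vec u \<odot> cl_vec v) = cl_vec u \<odot> ((cl_vec v \<odot> cl_vec u) \<odot> cl_vec v)"
    by (simp only: cl_mult_assoc)
  also have "\<dots> = - ((cl_vec u \<odot> cl_vec u) \<odot> (cl_vec v \<odot> cl_vec v))"
    by (simp only: cl_vec_anticommute [OF assms] cl.minus_left cl.minus_right cl_mult_assoc)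
  also have "\<dots> = - ((norm u * norm v)\<^sup>2) *\<^sub>R cl_one"
    by (simp add: cl_vec_square cl.scaleR_left cl.scaleR_right cl.minus_left cl.minus_right power_mult_distrib dot_square_norm)
  finally show ?thesis .
qed

lemma cl_comm_cl_vec_orthogonal:
  assumes "inner u v = 0"
  shows "cl_comm (cl_vec u) (cl_vec v) = 2 *\<^sub>R (cl_vec u \<odot> cl_vec v)"
  by (simp add: cl_comm_cl_vec assms)

text \<open>The component of \<open>u\<close> orthogonal to \<open>v\<close> (all of \<open>u\<close> when \<open>v = 0\<close>, because \<open>x / 0 = 0\<close>).\<close>

definition rejection :: "'a::real_inner \<Rightarrow> 'a \<Rightarrow> 'a" where
  "rejection v u = u - (inner u v / inner v v) *\<^sub>R v"

lemma inner_rejection: "inner (rejection v u) v = 0" "inner v (rejection v u) = 0"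
  by (cases "v = 0"; simp add: rejection_def inner_diff_left inner_diff_right inner_commute)+

lemma cl_comm_rejection: "cl_comm (cl_vec (rejection v u)) (cl_vec v) = cl_comm (cl_vec u) (cl_vec v)"
  by (simp add: cl_comm_def rejection_def cl.diff_left cl.diff_right cl.scaleR_left cl.scaleR_right)

lemma cl_comm_orthogonal_square:
  assumes "inner u v = 0"
  shows "cl_comm (cl_vec u) (cl_vec v) \<odot> cl_comm (cl_vec u) (cl_vec v)
    = - ((2 * (norm u * norm v))\<^sup>2) *\<^sub>R cl_one"
  by (simp add: cl_comm_cl_vec_orthogonal [OF assms] cl.scaleR_left cl.scaleR_right
      cl_mult_orthogonal_square [OF assms] power_mult_distrib)

text \<open>Removing from u its component along v leaves [u, v] unchanged, so u may be taken
  orthogonal to v. Then [u, v] = 2uv, and uvuv = -u^2 v^2 is a negative scalar unless u or v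
  vanishes.\<close>

lemma neg_square_cl_comm: "neg_square (cl_comm (cl_vec u) (cl_vec v))"
proof -
  define w where "w = rejection v u"
  have w: "inner w v = 0" "cl_comm (cl_vec w) (cl_vec v) = cl_comm (cl_vec u) (cl_vec v)"
    by (simp_all add: w_def inner_rejection cl_comm_rejection)
  show ?thesis
  proof (cases "w = 0 \<or> v = 0")
    case True
    then have "cl_comm (cl_vec w) (cl_vec v) = 0"
      by (auto simp: cl_comm_def cl.zero_left cl.zero_right)
    then show ?thesis
      by (simp add: neg_square_def w)
  next
    case False
    then have "2 * (norm w * norm v) \<noteq> 0"
      by simp
    then show ?thesis
      using cl_comm_orthogonal_square [OF w(1)] unfolding neg_square_def w(2) by blast
  qed
qed

lemma cl_comm_scaleR_left: "cl_comm (c *\<^sub>R x) y = c *\<^sub>R cl_comm x y"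
  by (simp add: cl_comm_def cl.scaleR_left cl.scaleR_right scaleR_diff_right)

lemma cl_comm_add_left: "cl_comm (x + x') y = cl_comm x y + cl_comm x' y"
  by (simp add: cl_comm_def cl.add_left cl.add_right)

text \<open>For y orthogonal to v one has (xv)(yv) = -xy v^2, so exchanging the commutators amounts
  to exchanging u and w, which anticommute.\<close>

lemma cl_comm_orthogonal_anticommute:
  assumes "inner u v = 0" "inner w v = 0" "inner u w = 0"
  shows "cl_comm (cl_vec w) (cl_vec v) \<odot> cl_comm (cl_vec u) (cl_vec v)
    = - (cl_comm (cl_vec u) (cl_vec v) \<odot> cl_comm (cl_vec w) (cl_vec v))"
proof -
  have *: "(cl_vec x \<odot> cl_vec v) \<odot> (cl_vec y \<odot> cl_vec v) = - ((cl_vec x \<odot> cl_vec y) \<odot> (cl_vec v \<odot> cl_vec v))"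
    if "inner y v = 0" for x y
  proof -
    have "(cl_vec x \<odot> cl_vec v) \<odot> (cl_vec y \<odot> cl_vec v) = cl_vec x \<odot> ((cl_vec v \<odot> cl_vec y) \<odot> cl_vec v)"
      by (simp only: cl_mult_assoc)
    then show ?thesis
      by (simp only: cl_vec_anticommute [OF that] cl.minus_left cl.minus_right cl_mult_assoc)
  qed
  show ?thesis
    by (simp add: cl_comm_cl_vec_orthogonal assms cl.scaleR_left cl.scaleR_right * 
        cl_vec_anticommute [OF assms(3)] cl.minus_left)
qed

lemma linear_rho_inf_cl_comm:
  assumes rep: "unitary_rep \<rho>"
  shows "linear (\<lambda>u. rho_inf \<rho> (cl_comm (cl_vec u) (cl_vec v)))"
proof -
  define D where "D u = rho_inf \<rho> (cl_comm (cl_vec u) (cl_vec v))" for u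
  have scale: "D (c *\<^sub>R u) = c *\<^sub>R D u" for c u
    unfolding D_def
    by (simp add: cl_comm_scaleR_left rho_inf_scaleR [OF rep cl_comm_in_spin_alg neg_square_cl_comm])
  have rej: "D (rejection v u) = D u" for u
    by (simp add: D_def cl_comm_rejection)
  have orth: "D (u + w) = D u + D w" if "inner u v = 0" "inner w v = 0" "inner u w = 0" for u w
    unfolding D_def cl_vec_linear_simps cl_comm_add_left
    by (intro rho_inf_add_anticommute rep cl_comm_in_spin_alg neg_square_cl_comm
        cl_comm_orthogonal_anticommute that)
  have add: "D (u + w) = D u + D w" for u w
  proof -
    \<comment> \<open>Gram-Schmidt: modulo \<open>v\<close>, which does not contribute, \<open>w\<close> is a multiple of \<open>u\<close> plus a vector
      orthogonal to both \<open>u\<close> and \<open>v\<close>.\<close>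
    define u' where "u' = rejection v u"
    define w' where "w' = rejection v w"
    define z where "z = rejection u' w'"
    define c where "c = inner w' u' / inner u' u'"
    have o: "inner u' v = 0" "inner w' v = 0" "inner u' z = 0"
      by (simp_all add: u'_def w'_def z_def inner_rejection)
    have w'_eq: "w' = c *\<^sub>R u' + z"
      by (simp add: z_def c_def rejection_def)
    have z: "inner z v = 0"
      using o by (simp add: w'_eq inner_add_left)
    have "rejection v (u + w) = (1 + c) *\<^sub>R u' + z"
      using w'_eq by (simp add: u'_def w'_def rejection_def inner_add_left add_divide_distrib algebra_simps)
    then have "D (u + w) = D ((1 + c) *\<^sub>R u' + z)"
      by (metis rej)
    \<comment> \<open>\<open>orth\<close> splits (1 + c) u' + z here and w' = c u' + z in the next
      step; the terms in u' then match by scaling.\<close>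
    also have "\<dots> = (1 + c) *\<^sub>R D u' + D z"
      using o z by (subst orth) (simp_all add: scale)
    also have "\<dots> = D u' + D w'"
      unfolding w'_eq using o z by (subst orth) (simp_all add: scale scaleR_add_left)
    finally show ?thesis
      by (simp add: u'_def w'_def rej)
  qed
  show ?thesis
    using add scale unfolding D_def by (intro linearI)
qed

text \<open>Carries linearity from the first argument over to the second.\<close>

lemma rho_inf_cl_comm_swap:
  assumes rep: "unitary_rep \<rho>"
  shows "rho_inf \<rho> (cl_comm (cl_vec v) (cl_vec u)) = - rho_inf \<rho> (cl_comm (cl_vec u) (cl_vec v))"
proof -
  have "cl_comm (cl_vec v) (cl_vec u) = (- 1) *\<^sub>R cl_comm (cl_vec u) (cl_vec v)"
    by (simp add: cl_comm_def)
  then show ?thesis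
    using rho_inf_scaleR [OF rep cl_comm_in_spin_alg neg_square_cl_comm, of "- 1" u v] by simp
qed

lemma rho_inf_cl_comm_expand_left:
  assumes rep: "unitary_rep \<rho>"
  shows "rho_inf \<rho> (cl_comm (cl_vec u) (cl_vec v))
    = (\<Sum>i\<in>UNIV. u $ i *\<^sub>R rho_inf \<rho> (cl_comm (cl_vec (ebas i)) (cl_vec v)))"
proof -
  note lin = linear_rho_inf_cl_comm [OF rep, of v]
  have "rho_inf \<rho> (cl_comm (cl_vec (\<Sum>i\<in>UNIV. u $ i *\<^sub>R ebas i)) (cl_vec v))
      = (\<Sum>i\<in>UNIV. u $ i *\<^sub>R rho_inf \<rho> (cl_comm (cl_vec (ebas i)) (cl_vec v)))"
    unfolding linear_sum [OF lin] linear_cmul [OF lin] ..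
  then show ?thesis
    by (simp only: ebas_expand)
qed

lemma rho_inf_cl_comm_expand_right:
  assumes rep: "unitary_rep \<rho>"
  shows "rho_inf \<rho> (cl_comm (cl_vec u) (cl_vec v))
    = (\<Sum>i\<in>UNIV. v $ i *\<^sub>R rho_inf \<rho> (cl_comm (cl_vec u) (cl_vec (ebas i))))"
proof -
  have "rho_inf \<rho> (cl_comm (cl_vec u) (cl_vec v))
      = (\<Sum>i\<in>UNIV. v $ i *\<^sub>R - rho_inf \<rho> (cl_comm (cl_vec (ebas i)) (cl_vec u)))"
    unfolding rho_inf_cl_comm_swap [OF rep, of u v]
    by (subst rho_inf_cl_comm_expand_left [OF rep]) (simp add: sum_negf)
  then show ?thesis
    by (simp only: rho_inf_cl_comm_swap [OF rep, of u "ebas _"])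
qed

section \<open>The adjoint representation\<close>

lemma linear_cl_deg1: "linear cl_deg1"
  by (auto intro!: linearI simp: cl_deg1_def vec_eq_iff)

lemma cl_deg1_cl_vec [simp]: "cl_deg1 (cl_vec u) = u"
  by (simp add: cl_deg1_def cl_vec_def vec_eq_iff)

text \<open>The product rule for e^{tX} u e^{-tX} at t = 0 gives Xu - uX, and the linear map
  \<open>cl_deg1\<close> passes through the derivative.\<close>

lemma Ad_inf_eq_commutator:
  assumes "neg_square X"
  shows "Ad_inf X u = cl_deg1 (cl_comm X (cl_vec u))"
proof -
  have Ad_eq: "Ad (cl_exp (t *\<^sub>R X)) u = cl_deg1 (cl_exp (t *\<^sub>R X) \<odot> cl_vec u \<odot> cl_exp (- t *\<^sub>R X))" for t
    unfolding Ad_def using cl_exp_minus_mult [OF assms, of t] by (simp add: cl_inv_eq)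
  have exp_deriv: "((\<lambda>t. cl_exp (t *\<^sub>R X)) has_vector_derivative X) (at 0)"
    using assms
  proof (cases rule: neg_square_cases)
    case (2 l)
    then show ?thesis
      unfolding cl_exp_eq_cos_sin [OF 2(2) less_imp_neq [OF 2(1), symmetric]]
      by (auto intro!: derivative_eq_intros simp flip: has_real_derivative_iff_has_vector_derivative)
  qed simp
  then have exp_deriv': "((\<lambda>t. cl_exp (- t *\<^sub>R X)) has_vector_derivative - X) (at 0)"
    using vector_diff_chain_at [of "\<lambda>t. - t" "- 1" 0 "\<lambda>t. cl_exp (t *\<^sub>R X)" X]
    by (simp add: o_def has_vector_derivative_minus [OF has_vector_derivative_id])
  have "((\<lambda>t. cl_exp (t *\<^sub>R X) \<odot> cl_vec u \<odot> cl_exp (- t *\<^sub>R X)) has_vector_derivative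
      cl_exp (0 *\<^sub>R X) \<odot> cl_vec u \<odot> (- X) + X \<odot> cl_vec u \<odot> cl_exp (- 0 *\<^sub>R X)) (at 0)"
    by (intro cl.has_vector_derivative exp_deriv'
        bounded_linear.has_vector_derivative [OF cl.bounded_linear_left] exp_deriv)
  then have "((\<lambda>t. cl_exp (t *\<^sub>R X) \<odot> cl_vec u \<odot> cl_exp (- t *\<^sub>R X)) has_vector_derivative
      cl_comm X (cl_vec u)) (at 0)"
    by (simp add: cl_comm_def cl.minus_right)
  then show ?thesis
    unfolding Ad_inf_def Ad_eq
    by (intro vector_derivative_at bounded_linear.has_vector_derivative
        [OF linear_conv_bounded_linear [THEN iffD1, OF linear_cl_deg1]])
qed

text \<open>Up to a central scalar [u, v] is 2uv, and moving w across v and then u costs 2 <v, w>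
  and 2 <u, w> by the Clifford relation; hence the factor 4.\<close>

lemma Ad_inf_cl_comm:
  "Ad_inf (cl_comm (cl_vec u) (cl_vec v)) w = 4 *\<^sub>R (inner u w *\<^sub>R v - inner v w *\<^sub>R u)"
proof -
  have c: "cl_vec x \<odot> cl_vec w = (- 2 * inner x w) *\<^sub>R cl_one - cl_vec w \<odot> cl_vec x" for x
    using clifford_relation [of x w] by (simp only: eq_diff_eq)
  have "cl_vec u \<odot> cl_vec v \<odot> cl_vec w
      = (- 2 * inner v w) *\<^sub>R cl_vec u - (cl_vec u \<odot> cl_vec w) \<odot> cl_vec v"
    by (simp only: cl_mult_assoc c [of v] cl.diff_right cl.scaleR_right cl_one_mult)
  also have "\<dots> = (- 2 * inner v w) *\<^sub>R cl_vec u + (2 * inner u w) *\<^sub>R cl_vec v + cl_vec w \<odot> (cl_vec u \<odot> cl_vec v)"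
    by (simp add: c [of u] cl.diff_left cl.minus_left cl.scaleR_left cl_mult_assoc)
  finally have uvw: "cl_vec u \<odot> cl_vec v \<odot> cl_vec w
      = (- 2 * inner v w) *\<^sub>R cl_vec u + (2 * inner u w) *\<^sub>R cl_vec v + cl_vec w \<odot> (cl_vec u \<odot> cl_vec v)" .
  have "cl_comm (cl_comm (cl_vec u) (cl_vec v)) (cl_vec w)
    = cl_vec (4 *\<^sub>R (inner u w *\<^sub>R v - inner v w *\<^sub>R u))"
    unfolding cl_comm_cl_vec [of u v] cl_comm_def [of _ "cl_vec w"]
    by (simp add: uvw cl.add_left cl.add_right cl.scaleR_left cl.scaleR_right scaleR_add_right scaleR_diff_right)
  then show ?thesis
    by (simp only: Ad_inf_eq_commutator [OF neg_square_cl_comm] cl_deg1_cl_vec)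
qed

section \<open>Orthogonal projections and adjoints\<close>

lemma cinner_diff_right: "cinner x (y - z) = cinner x y - cinner x z"
  and cinner_cnj: "cnj (cinner x y) = cinner y x"
  by (simp_all add: cinner_def algebra_simps sum_subtractf)

lemma cinner_sum_right: "cinner x (\<Sum>i\<in>I. f i) = (\<Sum>i\<in>I. cinner x (f i))"
  unfolding cinner_def sum_component sum_distrib_left by (rule sum.swap)

lemma cinner_self_eq_0: "cinner x x = 0 \<longleftrightarrow> x = 0"
proof
  assume "cinner x x = 0"
  moreover have "Re (cinner x x) = (\<Sum>i\<in>UNIV. (cmod (x $ i))\<^sup>2)"
    unfolding cmod_power2 by (simp add: cinner_def power2_eq_square)
  ultimately have "(\<Sum>i\<in>UNIV. (cmod (x $ i))\<^sup>2) = 0"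
    by simp
  then show "x = 0"
    by (simp add: sum_nonneg_eq_0_iff vec_eq_iff)
qed (simp add: cinner_def)

text \<open>Two candidates for the definite description in \<open>cproj\<close> differ by an element
  of W that is orthogonal to itself.\<close>

lemma cproj_eqI:
  assumes W: "csubspace W" and w: "w \<in> W" "\<And>x. x \<in> W \<Longrightarrow> cinner x (t - w) = 0"
  shows "cproj W t = w"
  unfolding cproj_def
proof (rule the_equality)
  fix w' assume w': "w' \<in> W \<and> (\<forall>x\<in>W. cinner x (t - w') = 0)"
  have "w + cscale (- 1) w' \<in> W"
    using W w w' unfolding csubspace_def by blast
  moreover have "w + cscale (- 1) w' = w - w'"
    by (simp add: cscale_def vec_eq_iff)
  ultimately have "w - w' \<in> W"
    by simp
  then have "cinner (w - w') (t - w') - cinner (w - w') (t - w) = 0"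
    using w w' by simp
  then have "cinner (w - w') (w - w') = 0"
    by (simp add: cinner_diff_right)
  then show "w' = w"
    by (simp add: cinner_self_eq_0)
qed (use w in auto)

lemma cadj_eqI:
  assumes "\<And>x y. cinner (f x) y = cinner x (g y)"
  shows "cadj f = g"
  unfolding cadj_def
proof (rule the_equality)
  fix g' assume g': "\<forall>x y. cinner (f x) y = cinner x (g' y)"
  show "g' = g"
  proof
    fix y
    have "cinner x (g' y) = cinner x (g y)" for x
      using g' assms by metis
    then have "cinner (g' y - g y) (g' y - g y) = 0"
      by (simp add: cinner_diff_right)
    then show "g' y = g y"
      by (simp add: cinner_self_eq_0)
  qed
qed (use assms in auto)

text \<open>Both sides equal the inner product of the two projections. The existence hypothesis
  makes \<open>cproj\<close> meaningful; an orthogonal decomposition supplies it.\<close>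

lemma cinner_cproj:
  assumes W: "csubspace W"
    and ex: "\<And>t. \<exists>w\<in>W. \<forall>x\<in>W. cinner x (t - w) = 0"
  shows "cinner (cproj W s) t = cinner s (cproj W t)"
proof -
  have P: "cproj W t \<in> W" "x \<in> W \<Longrightarrow> cinner x t = cinner x (cproj W t)" for t x
  proof -
    obtain w where w: "w \<in> W" "\<forall>x\<in>W. cinner x (t - w) = 0"
      using ex by blast
    then have "cproj W t = w"
      by (intro cproj_eqI W) auto
    then show "cproj W t \<in> W" "x \<in> W \<Longrightarrow> cinner x t = cinner x (cproj W t)"
      using w by (auto simp: cinner_diff_right)
  qed
  have "cinner (cproj W s) t = cinner (cproj W s) (cproj W t)"
    by (rule P(2) [OF P(1)])
  also have "\<dots> = cnj (cinner (cproj W t) (cproj W s))"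
    by (simp add: cinner_cnj)
  also have "\<dots> = cnj (cinner (cproj W t) s)"
    by (simp add: P(2) [OF P(1), of t s])
  finally show ?thesis
    by (simp add: cinner_cnj)
qed

section \<open>Slices of a tensor along the vector factor\<close>

text \<open>Reads V_\<rho> \<otimes> R^n as n copies of V_\<rho>, so that \<open>tensor_op\<close>
  becomes a block matrix.\<close>

definition slice :: "complex ^ ('d::finite \<times> 'n::{finite,linorder}) \<Rightarrow> 'n \<Rightarrow> complex ^ 'd" where
  "slice t k = (\<chi> b. t $ (b, k))"

text \<open>The adjoint of \<phi> -> \<phi> \<otimes> u, as \<open>cinner_tensor\<close>
  shows.\<close>

definition contract :: "real ^ 'n::{finite,linorder} \<Rightarrow> complex ^ ('d::finite \<times> 'n) \<Rightarrow> complex ^ 'd" where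
  "contract u t = (\<Sum>c\<in>UNIV. u $ c *\<^sub>R slice t c)"

lemma slice_eqI: "(\<And>c. slice s c = slice t c) \<Longrightarrow> s = t"
  by (auto simp: slice_def vec_eq_iff)

lemma slice_linear:
    "slice (r *\<^sub>R t) c = r *\<^sub>R slice t c" "slice (cscale z t) c = cscale z (slice t c)"
  by (simp_all add: slice_def vec_eq_iff cscale_def)

lemma slice_sum: "slice (\<Sum>i\<in>I. f i) c = (\<Sum>i\<in>I. slice (f i) c)"
  by (simp add: slice_def vec_eq_iff)

lemma slice_tensor: "slice (tensor \<phi> v) k = v $ k *\<^sub>R \<phi>"
  by (simp add: slice_def tensor_def vec_eq_iff scaleR_conv_of_real [where 'a = complex] mult.commute)

lemma contract_sum: "contract u (\<Sum>i\<in>I. f i) = (\<Sum>i\<in>I. contract u (f i))"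
  unfolding contract_def slice_sum scaleR_sum_right by (rule sum.swap)

lemma contract_cscale: "contract u (cscale z t) = cscale z (contract u t)"
  unfolding contract_def slice_linear
  by (simp add: vec_eq_iff cscale_def sum_distrib_left scaleR_conv_of_real [where 'a = complex] mult_ac)

lemma cinner_tensor: "cinner (tensor \<phi> u) t = cinner \<phi> (contract u t)"
proof -
  have "cinner (tensor \<phi> u) t = (\<Sum>a\<in>UNIV. \<Sum>c\<in>UNIV. cnj (tensor \<phi> u $ (a, c)) * t $ (a, c))"
    unfolding cinner_def UNIV_Times_UNIV [symmetric] sum.cartesian_product
    by (intro sum.cong) auto
  also have "\<dots> = cinner \<phi> (contract u t)"
    by (simp add: cinner_def contract_def tensor_def slice_def sum_distrib_left scaleR_conv_of_real [where 'a = complex] mult_ac)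
  finally show ?thesis .
qed

lemma matrix_vector_scaleR_left: "(r *\<^sub>R A) *v x = r *\<^sub>R (A *v (x :: complex ^ 'a))"
  by (simp add: matrix_vector_mult_def vec_eq_iff scaleR_sum_right)

lemma matrix_vector_scaleR_right: "A *v (r *\<^sub>R x) = r *\<^sub>R (A *v (x :: complex ^ 'a))"
  by (simp add: matrix_vector_mult_def vec_eq_iff scaleR_sum_right)

lemma matrix_vector_sum_left: "(\<Sum>i\<in>I. A i) *v x = (\<Sum>i\<in>I. A i *v (x :: complex ^ 'a))"
  by (induction I rule: infinite_finite_induct) (simp_all add: matrix_vector_mult_add_rdistrib)

lemma matrix_vector_sum_right: "A *v (\<Sum>i\<in>I. x i) = (\<Sum>i\<in>I. A *v (x i :: complex ^ 'a))"
  by (induction I rule: infinite_finite_induct) (simp_all add: matrix_vector_right_distrib)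

lemma slice_tensor_op:
  "slice (tensor_op A B t) c = (\<Sum>k\<in>UNIV. B (ebas k) $ c *\<^sub>R (A *v slice t k))"
proof -
  have "(\<Sum>b\<in>UNIV. \<Sum>k\<in>UNIV. A $ a $ b * complex_of_real (B (ebas k) $ c) * t $ (b, k))
      = (\<Sum>k\<in>UNIV. \<Sum>b\<in>UNIV. B (ebas k) $ c *\<^sub>R (A $ a $ b * t $ (b, k)))" for a
    by (subst sum.swap) (simp add: scaleR_conv_of_real [where 'a = complex] mult_ac)
  then show ?thesis
    by (simp add: slice_def tensor_op_def vec_eq_iff matrix_vector_mult_def scaleR_sum_right)
qed

lemma inner_ebas: "inner (ebas i) (ebas k) = (if i = k then 1 else 0)"
  and ebas_component: "ebas i $ k = (if i = k then 1 else 0)"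
  by (simp_all add: ebas_def inner_axis_axis) (simp add: axis_def)

section \<open>The conformal weight operator and its powers in block form\<close>

lemma slice_Cas:
  assumes rep: "unitary_rep \<rho>"
  shows "slice (Cas \<rho> t) c
    = (- 1 / 4) *\<^sub>R (\<Sum>k\<in>UNIV. rho_inf \<rho> (cl_comm (cl_vec (ebas c)) (cl_vec (ebas k))) *v slice t k)"
proof -
  define R where "R i j = rho_inf \<rho> (cl_comm (cl_vec (ebas i)) (cl_vec (ebas j)))" for i j
  have R: "R j i = - R i j" for i j
    unfolding R_def by (rule rho_inf_cl_comm_swap [OF rep])
  define A where "A i j = slice (tensor_op (R i j) (Ad_inf (cl_comm (cl_vec (ebas i)) (cl_vec (ebas j)))) t) c" for i j
  \<comment> \<open>Component c of Ad([e_i, e_j]) e_k is 4 (\<delta>_ik \<delta>_jc - \<delta>_jk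
    \<delta>_ic). By antisymmetry of R both terms contribute the same sum over row c, whence -8/32 =
    -1/4.\<close>
  have A: "A i j = (if j = c then 4 *\<^sub>R (R i c *v slice t i) else 0) - (if i = c then 4 *\<^sub>R (R c j *v slice t j) else 0)"
    for i j
  proof -
    have "A i j = (\<Sum>k\<in>UNIV. (if k = i then (if j = c then 4 *\<^sub>R (R i c *v slice t i) else 0) else 0)
        - (if k = j then (if i = c then 4 *\<^sub>R (R c j *v slice t j) else 0) else 0))"
      unfolding A_def slice_tensor_op Ad_inf_cl_comm
      by (intro sum.cong refl) (auto simp: inner_ebas ebas_component)
    then show ?thesis
      by (simp add: sum_subtractf)
  qed
  have "slice (Cas \<rho> t) c = (1 / 32) *\<^sub>R (\<Sum>i\<in>UNIV. \<Sum>j\<in>UNIV. A i j)"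
    by (simp add: Cas_def slice_linear slice_sum A_def R_def)
  also have "(\<Sum>i\<in>UNIV. \<Sum>j\<in>UNIV. A i j)
      = (\<Sum>i\<in>UNIV. 4 *\<^sub>R (R i c *v slice t i)) - (\<Sum>j\<in>UNIV. 4 *\<^sub>R (R c j *v slice t j))"
  proof -
    have "(\<Sum>i\<in>UNIV. \<Sum>j\<in>UNIV. if i = c then 4 *\<^sub>R (R c j *v slice t j) else 0)
        = (\<Sum>j\<in>UNIV. 4 *\<^sub>R (R c j *v slice t j))"
      by (subst sum.swap) simp
    then show ?thesis
      by (simp add: A sum_subtractf)
  qed
  also have "(\<Sum>i\<in>UNIV. 4 *\<^sub>R (R i c *v slice t i)) = - (\<Sum>i\<in>UNIV. 4 *\<^sub>R (R c i *v slice t i))"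
    by (subst R [of _ c]) (simp add: sum_negf matrix_vector_scaleR_left [of "- 1", simplified])
  finally show ?thesis
    by (simp add: R_def scaleR_sum_right [symmetric] scaleR_diff_right)
qed

lemma Cas_sum:
  assumes rep: "unitary_rep \<rho>"
  shows "Cas \<rho> (\<Sum>i\<in>I. f i) = (\<Sum>i\<in>I. Cas \<rho> (f i))"
proof (rule slice_eqI)
  fix c
  show "slice (Cas \<rho> (\<Sum>i\<in>I. f i)) c = slice (\<Sum>i\<in>I. Cas \<rho> (f i)) c"
    unfolding slice_sum slice_Cas [OF rep] matrix_vector_sum_right scaleR_sum_right
    by (rule sum.swap)
qed

text \<open>The recursion of \<open>rchain\<close> at its left end is the row-by-column rule for
  blocks. Exponents start at 1 because \<open>rchain \<rho> 0\<close> is a filler value; the base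
  case rests on linearity in v.\<close>

lemma slice_Cas_power_tensor:
  assumes rep: "unitary_rep \<rho>"
  shows "slice ((Cas \<rho> ^^ Suc q) (tensor \<phi> v)) c = ((- 1 / 4) ^ Suc q) *\<^sub>R (rchain \<rho> (Suc q) (ebas c) v *v \<phi>)"
proof (induction q arbitrary: c)
  case 0
  show ?case
    by (simp add: slice_Cas [OF rep] slice_tensor rho_inf_cl_comm_expand_right [OF rep, of "ebas c" v]
        matrix_vector_sum_left matrix_vector_scaleR_left matrix_vector_scaleR_right)
next
  case (Suc q)
  have "slice ((Cas \<rho> ^^ Suc (Suc q)) (tensor \<phi> v)) c
    = (- 1 / 4) *\<^sub>R (\<Sum>k\<in>UNIV. rho_inf \<rho> (cl_comm (cl_vec (ebas c)) (cl_vec (ebas k))) *v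
        (((- 1 / 4) ^ Suc q) *\<^sub>R (rchain \<rho> (Suc q) (ebas k) v *v \<phi>)))"
    unfolding funpow.simps(2) [of "Suc q"] o_apply slice_Cas [OF rep] Suc ..
  also have "\<dots> = ((- 1 / 4) ^ Suc (Suc q)) *\<^sub>R (rchain \<rho> (Suc (Suc q)) (ebas c) v *v \<phi>)"
    by (simp only: matrix_vector_sum_left matrix_vector_scaleR_right matrix_vector_mul_assoc
        scaleR_sum_right [symmetric] scaleR_scaleR power_Suc [of _ "Suc q"] rchain.simps(3))
  finally show ?case .
qed

text \<open>Only the leftmost factor of a chain involves u.\<close>

lemma rchain_expand_left:
  assumes rep: "unitary_rep \<rho>"
  shows "rchain \<rho> (Suc q) u v = (\<Sum>c\<in>UNIV. u $ c *\<^sub>R rchain \<rho> (Suc q) (ebas c) v)"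
proof (cases q)
  case 0
  then show ?thesis
    by (simp add: rho_inf_cl_comm_expand_left [OF rep, of u])
next
  case (Suc p)
  have "rchain \<rho> (Suc (Suc p)) u v = (\<Sum>l\<in>UNIV. \<Sum>c\<in>UNIV.
      u $ c *\<^sub>R (rho_inf \<rho> (cl_comm (cl_vec (ebas c)) (cl_vec (ebas l))) ** rchain \<rho> (Suc p) (ebas l) v))"
    unfolding rchain.simps(3) rho_inf_cl_comm_expand_left [OF rep, of u] mm.sum_left mm.scaleR_left ..
  also have "\<dots> = (\<Sum>c\<in>UNIV. u $ c *\<^sub>R rchain \<rho> (Suc (Suc p)) (ebas c) v)"
    unfolding rchain.simps(3) scaleR_sum_right by (rule sum.swap)
  finally show ?thesis
    by (simp add: Suc)
qed

lemma contract_Cas_power_tensor: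
  assumes rep: "unitary_rep \<rho>"
  shows "contract u ((Cas \<rho> ^^ q) (tensor \<phi> v)) = rq \<rho> q u v *v \<phi>"
proof (cases q)
  case 0
  have "(\<Sum>c\<in>UNIV. u $ c *\<^sub>R v $ c *\<^sub>R \<phi>) = inner u v *\<^sub>R \<phi>"
    by (simp add: inner_vec_def scaleR_sum_left)
  also have "\<dots> = mat (complex_of_real (inner u v)) *v \<phi>"
    by (simp add: vec_eq_iff matrix_vector_mult_def mat_def scaleR_conv_of_real [where 'a = complex] if_distribR if_distrib cong: if_cong)
  finally show ?thesis
    by (simp add: 0 contract_def slice_tensor rq_def)
next
  case (Suc p)
  have "contract u ((Cas \<rho> ^^ Suc p) (tensor \<phi> v))
     = ((- 1 / 4) ^ Suc p) *\<^sub>R ((\<Sum>c\<in>UNIV. u $ c *\<^sub>R rchain \<rho> (Suc p) (ebas c) v) *v \<phi>)"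
    unfolding contract_def slice_Cas_power_tensor [OF rep] matrix_vector_sum_left matrix_vector_scaleR_left
      scaleR_sum_right
    by (simp add: mult.commute)
  also have "\<dots> = (((- 1 / 4) ^ Suc p) *\<^sub>R rchain \<rho> (Suc p) u v) *v \<phi>"
    by (simp only: rchain_expand_left [OF rep, symmetric] matrix_vector_scaleR_left)
  also have "((- 1 / 4) ^ Suc p) *\<^sub>R rchain \<rho> (Suc p) u v = rq \<rho> q u v"
    by (simp add: rq_def Suc vec_eq_iff scaleR_conv_of_real [where 'a = complex] del: power_Suc)
  finally show ?thesis
    by (simp add: Suc)
qed

section \<open>Spectral decomposition over the irreducible summands\<close>

theorem theorem3p6:
  fixes \<rho> :: "real ^ ('n::{finite,linorder} set) \<Rightarrow> complex ^ 'd::finite ^ 'd"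
    and W :: "nat \<Rightarrow> (complex ^ ('d \<times> 'n::{finite,linorder})) set"
    and N :: nat
    and m :: "nat \<Rightarrow> complex"
    and q :: nat
    and u v :: "real ^ 'n::{finite,linorder}"
  assumes rep: "unitary_rep \<rho>"
    and irr: "irreducible_rep \<rho>"
    and irr_sum: "\<forall>k\<le>N. irred_submodule (tensor_act \<rho>) (W k)"
    and orth: "\<forall>k\<le>N. \<forall>k'\<le>N. k \<noteq> k' \<longrightarrow> (\<forall>x\<in>W k. \<forall>y\<in>W k'. cinner x y = 0)"
    and span: "\<forall>t. \<exists>w. (\<forall>k\<le>N. w k \<in> W k) \<and> t = (\<Sum>k\<le>N. w k)"
    and weight: "\<forall>k\<le>N. \<forall>t\<in>W k. Cas \<rho> t = cscale (m k) t"
  shows "(\<lambda>\<phi>. \<Sum>k\<le>N. cscale (m k ^ q) (cadj (cliff_hom (W k) u) (cliff_hom (W k) v \<phi>)))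
         = (\<lambda>\<phi>. rq \<rho> q u v *v \<phi>)"
proof
  fix \<phi> :: "complex ^ 'd"
  have sub: "csubspace (W k)" if "k \<le> N" for k
    using irr_sum that by (simp add: irred_submodule_def)
  \<comment> \<open>The components other than the k-th are orthogonal to W k, so projecting onto W k
    selects the k-th component.\<close>
  have ortho: "cinner x ((\<Sum>j\<le>N. w j) - w k) = 0"
    if "k \<le> N" "\<forall>j\<le>N. w j \<in> W j" "x \<in> W k" for w k x
  proof -
    have "cinner x ((\<Sum>j\<le>N. w j) - w k) = (\<Sum>j\<in>{..N} - {k}. cinner x (w j))"
      using that by (simp add: sum_diff1 cinner_diff_right cinner_sum_right)
    also have "\<dots> = 0"
      using that orth [rule_format, of k _ x "w _"] by (intro sum.neutral) auto
    finally show ?thesis .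
  qed
  have ex: "\<exists>w\<in>W k. \<forall>x\<in>W k. cinner x (t - w) = 0" if "k \<le> N" for k t
    using span [rule_format, of t] ortho [OF that] that by blast
  \<comment> \<open>The Clifford homomorphism is a self-adjoint projection after \<phi> -> \<phi>
    \<otimes> u, so its adjoint projects first and contracts afterwards.\<close>
  have adj: "cadj (cliff_hom (W k) u) y = contract u (cproj (W k) y)" if "k \<le> N" for k y
  proof -
    have "cadj (cliff_hom (W k) u) = (\<lambda>y. contract u (cproj (W k) y))"
      by (rule cadj_eqI) (simp add: cliff_hom_def cinner_cproj [OF sub ex] that cinner_tensor)
    then show ?thesis by simp
  qed
  obtain w where w: "\<forall>k\<le>N. w k \<in> W k" "tensor \<phi> v = (\<Sum>k\<le>N. w k)"
    using span by blast
  \<comment> \<open>The second identity is idempotence: the product of the adjoint with the Clifford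
    homomorphism projects twice.\<close>
  have proj: "cproj (W k) (tensor \<phi> v) = w k" "cproj (W k) (w k) = w k" if "k \<le> N" for k
    using w that ortho [OF that w(1)] by (auto intro!: cproj_eqI sub simp: cinner_def)
  have power: "(Cas \<rho> ^^ q) (tensor \<phi> v) = (\<Sum>k\<le>N. cscale (m k ^ q) (w k))"
  proof (induction q)
    case 0
    then show ?case
      by (simp add: w cscale_def vec_eq_iff)
  next
    case (Suc q)
    have "Cas \<rho> (cscale (m k ^ q) (w k)) = cscale (m k ^ Suc q) (w k)" if "k \<le> N" for k
    proof -
      have "cscale (m k ^ q) (w k) \<in> W k"
        using sub [OF that] w that by (simp add: csubspace_def)
      then have "Cas \<rho> (cscale (m k ^ q) (w k)) = cscale (m k) (cscale (m k ^ q) (w k))"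
        using weight that by blast
      then show ?thesis
        by (simp add: cscale_def vec_eq_iff)
    qed
    then show ?case
      by (simp add: Suc Cas_sum [OF rep])
  qed
  have "(\<Sum>k\<le>N. cscale (m k ^ q) (cadj (cliff_hom (W k) u) (cliff_hom (W k) v \<phi>)))
      = (\<Sum>k\<le>N. contract u (cscale (m k ^ q) (w k)))"
    by (intro sum.cong refl) (simp add: adj cliff_hom_def proj contract_cscale)
  also have "\<dots> = rq \<rho> q u v *v \<phi>"
    by (simp only: contract_sum [symmetric] power [symmetric] contract_Cas_power_tensor [OF rep])
  finally show "(\<Sum>k\<le>N. cscale (m k ^ q) (cadj (cliff_hom (W k) u) (cliff_hom (W k) v \<phi>)))
      = rq \<rho> q u v *v \<phi>" .
qed

end
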